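(* Let $(X,d)$ be a compact pointed metric space such that $\mathrm{lip}_0(X)$ separates points uniformly, let $((x_n,y_n))_{n=1}^\infty$ be a sequence of distinct points in $\widetilde X$, let $T$ be its Lipschitz interpolating operator, and let $M\geq 1$. The following statements are equivalent: (i) $((x_n,y_n))_{n=1}^\infty$ is Lipschitz interpolating for $\mathrm{Lip}_0(X)$ and its Lipschitz interpolation constant is $M$. (ii) The operator $S:\ell_1\to\mathcal F(X)$ defined by $S(e_n)=m_{x_n,y_n}$ (i.e. $S(\lambda)=\sum_n\lambda_n m_{x_n,y_n}$) is an into isomorphism and $\frac1M=\max\{J>0: J\|\lambda\|_1\le\|S(\lambda)\|\ \forall\lambda\in\ell_1\}$. (iii) $((x_n,y_n))_{n=1}^\infty$ is Lipschitz $c_0$-interpolating for $\mathrm{lip}_0(X)$, i.e. for every $\alpha\in c_0$ there is $f\in\mathrm{lip}_0(X)$ with $T(f)=\alpha$, and $M=\inf\{K>0: \forall\alpha\in c_0,\ \|\alpha\|_\infty\le1,\ \exists f\in\mathrm{lip}_0(X),\ \|f\|\le K,\ T(f)=\alpha\}$. (iv) $M=\inf\{K>0: \forall \alpha\in c_0,\ \|\alpha\|_\infty\le 1,\ \exists f\in\mathrm{Lip}_0(X),\ \|f\|\le K,\ T(f)=\alpha\}$ (and in particular this set of constants is nonempty).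
   Context: All spaces are real. $(X,d)$ has a base point $0$, $\widetilde{X}=\{(x,y)\in X\times X: x\neq y\}$. $\mathrm{Lip}_0(X)$ is the Banach space of Lipschitz $f:X\to\mathbb{R}$ with $f(0)=0$, normed by $\|f\|=\sup_{(x,y)\in\widetilde X}|f(x)-f(y)|/d(x,y)$. $\mathrm{lip}_0(X)$ is the closed subspace of those $f$ such that for every $\varepsilon>0$ there is $\delta>0$ with $|f(x)-f(y)|/d(x,y)<\varepsilon$ whenever $0<d(x,y)<\delta$. $\mathrm{lip}_0(X)$ separates points uniformly if there is a constant $a>1$ such that for all $x,y\in X$ some $f\in\mathrm{lip}_0(X)$ has $\|f\|\le a$ and $|f(x)-f(y)|=d(x,y)$. For $x\in X$, $\delta_x\in\mathrm{Lip}_0(X)^*$ is $\delta_x(f)=f(x)$; $\mathcal F(X)$ is the closed linear span of $\{\delta_x\}$ in $\mathrm{Lip}_0(X)^*$; $m_{x,y}=(\delta_x-\delta_y)/d(x,y)$. $e_n$ are the unit vectors of $\ell_1$. The Lipschitz interpolating operator of the sequence is $T(f)=\big((f(x_n)-f(y_n))/d(x_n,y_n)\big)_{n}$ for $f\in\mathrm{Lip}_0(X)$. The sequence is Lipschitz interpolating for $\mathrm{Lip}_0(X)$ if $T:\mathrm{Lip}_0(X)\to\ell_\infty$ is surjective, and then its Lipschitz interpolation constant is $\inf\{K\geq1:\forall\alpha\in\ell_\infty,\|\alpha\|_\infty\le1,\ \exists f\in\mathrm{Lip}_0(X),\ \|f\|\le K,\ T(f)=\alpha\}$. *)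

theory Defs
  imports "HOL-Analysis.Analysis"
begin

text \<open>The pointed metric space is a set X in a metric space type with base point z \<in> X.
  Lipschitz functions are real-valued functions; only their values on X matter.\<close>

definition lipnorm :: "'a::metric_space set \<Rightarrow> ('a \<Rightarrow> real) \<Rightarrow> real" where
  "lipnorm X f = (SUP p \<in> {(x, y). x \<in> X \<and> y \<in> X \<and> x \<noteq> y}.
                    \<bar>f (fst p) - f (snd p)\<bar> / dist (fst p) (snd p))"

definition Lip0 :: "'a::metric_space set \<Rightarrow> 'a \<Rightarrow> ('a \<Rightarrow> real) set" where
  "Lip0 X z = {f. f z = 0 \<and> (\<exists>L. \<forall>x\<in>X. \<forall>y\<in>X. \<bar>f x - f y\<bar> \<le> L * dist x y)}"

definition lip0 :: "'a::metric_space set \<Rightarrow> 'a \<Rightarrow> ('a \<Rightarrow> real) set" where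
  "lip0 X z = {f \<in> Lip0 X z. \<forall>\<epsilon>>0. \<exists>\<delta>>0. \<forall>x\<in>X. \<forall>y\<in>X.
       0 < dist x y \<and> dist x y < \<delta> \<longrightarrow> \<bar>f x - f y\<bar> / dist x y < \<epsilon>}"

definition separates_points_uniformly :: "'a::metric_space set \<Rightarrow> 'a \<Rightarrow> bool" where
  "separates_points_uniformly X z \<longleftrightarrow> (\<exists>a>1. \<forall>x\<in>X. \<forall>y\<in>X.
       \<exists>f \<in> lip0 X z. lipnorm X f \<le> a \<and> \<bar>f x - f y\<bar> = dist x y)"

definition interp_op :: "(nat \<Rightarrow> 'a::metric_space) \<Rightarrow> (nat \<Rightarrow> 'a) \<Rightarrow> ('a \<Rightarrow> real) \<Rightarrow> nat \<Rightarrow> real" where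
  "interp_op xs ys f n = (f (xs n) - f (ys n)) / dist (xs n) (ys n)"

definition linfty :: "(nat \<Rightarrow> real) set" where
  "linfty = {\<alpha>. bounded (range \<alpha>)}"

definition c0 :: "(nat \<Rightarrow> real) set" where
  "c0 = {\<alpha>. \<alpha> \<longlonglongrightarrow> 0}"

definition l1 :: "(nat \<Rightarrow> real) set" where
  "l1 = {lam. summable (\<lambda>n. \<bar>lam n\<bar>)}"

definition l1norm :: "(nat \<Rightarrow> real) \<Rightarrow> real" where
  "l1norm lam = (\<Sum>n. \<bar>lam n\<bar>)"

definition Lip_interpolating :: "'a::metric_space set \<Rightarrow> 'a \<Rightarrow> (nat \<Rightarrow> 'a) \<Rightarrow> (nat \<Rightarrow> 'a) \<Rightarrow> bool" where
  "Lip_interpolating X z xs ys \<longleftrightarrow> (\<forall>\<alpha>\<in>linfty. \<exists>f\<in>Lip0 X z. interp_op xs ys f = \<alpha>)"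

definition Lip_interp_constants :: "'a::metric_space set \<Rightarrow> 'a \<Rightarrow> (nat \<Rightarrow> 'a) \<Rightarrow> (nat \<Rightarrow> 'a) \<Rightarrow> real set" where
  "Lip_interp_constants X z xs ys = {K. K \<ge> 1 \<and> (\<forall>\<alpha>\<in>linfty. (\<forall>n. \<bar>\<alpha> n\<bar> \<le> 1) \<longrightarrow>
       (\<exists>f\<in>Lip0 X z. lipnorm X f \<le> K \<and> interp_op xs ys f = \<alpha>))}"

definition Lip_interp_constant :: "'a::metric_space set \<Rightarrow> 'a \<Rightarrow> (nat \<Rightarrow> 'a) \<Rightarrow> (nat \<Rightarrow> 'a) \<Rightarrow> real" where
  "Lip_interp_constant X z xs ys = Inf (Lip_interp_constants X z xs ys)"

definition c0_interp_constants :: "'a::metric_space set \<Rightarrow> ('a \<Rightarrow> real) set \<Rightarrow> (nat \<Rightarrow> 'a) \<Rightarrow> (nat \<Rightarrow> 'a) \<Rightarrow> real set" where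
  "c0_interp_constants X F xs ys = {K. K > 0 \<and> (\<forall>\<alpha>\<in>c0. (\<forall>n. \<bar>\<alpha> n\<bar> \<le> 1) \<longrightarrow>
       (\<exists>f\<in>F. lipnorm X f \<le> K \<and> interp_op xs ys f = \<alpha>))}"

definition Lip_c0_interpolating :: "('a \<Rightarrow> real) set \<Rightarrow> (nat \<Rightarrow> 'a::metric_space) \<Rightarrow> (nat \<Rightarrow> 'a) \<Rightarrow> bool" where
  "Lip_c0_interpolating F xs ys \<longleftrightarrow> (\<forall>\<alpha>\<in>c0. \<exists>f\<in>F. interp_op xs ys f = \<alpha>)"

definition dual_norm :: "'a::metric_space set \<Rightarrow> 'a \<Rightarrow> (('a \<Rightarrow> real) \<Rightarrow> real) \<Rightarrow> real" where
  "dual_norm X z \<phi> = Sup {\<bar>\<phi> f\<bar> | f. f \<in> Lip0 X z \<and> lipnorm X f \<le> 1}"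

text \<open>The operator S : l1 \<rightarrow> F(X), S(lam) = \<Sum> lam_n m_{x_n,y_n}, as an element of Lip0(X)^*:
  S(lam)(f) = \<Sum> lam_n (f(x_n) - f(y_n))/d(x_n,y_n).\<close>
definition Sop :: "(nat \<Rightarrow> 'a::metric_space) \<Rightarrow> (nat \<Rightarrow> 'a) \<Rightarrow> (nat \<Rightarrow> real) \<Rightarrow> ('a \<Rightarrow> real) \<Rightarrow> real" where
  "Sop xs ys lam f = (\<Sum>n. lam n * interp_op xs ys f n)"

definition Sop_into_isomorphism :: "'a::metric_space set \<Rightarrow> 'a \<Rightarrow> (nat \<Rightarrow> 'a) \<Rightarrow> (nat \<Rightarrow> 'a) \<Rightarrow> bool" where
  "Sop_into_isomorphism X z xs ys \<longleftrightarrow> (\<exists>c>0. \<exists>C. \<forall>lam\<in>l1.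
       c * l1norm lam \<le> dual_norm X z (Sop xs ys lam) \<and> dual_norm X z (Sop xs ys lam) \<le> C * l1norm lam)"

definition Sop_lower_constants :: "'a::metric_space set \<Rightarrow> 'a \<Rightarrow> (nat \<Rightarrow> 'a) \<Rightarrow> (nat \<Rightarrow> 'a) \<Rightarrow> real set" where
  "Sop_lower_constants X z xs ys = {J. J > 0 \<and> (\<forall>lam\<in>l1. J * l1norm lam \<le> dual_norm X z (Sop xs ys lam))}"

end

theory Submission
  imports Defs "HOL-Library.Landau_Symbols"
begin

text \<open>
  A constant \<open>K\<close> is admissible for interpolation of null sequences by \<open>Lip\<^sub>0\<close> functions iff
  \<open>\<parallel>\<lambda>\<parallel>\<^sub>1 \<le> K \<parallel>S \<lambda>\<parallel>\<close> for all \<open>\<lambda> \<in> \<ell>\<^sub>1\<close>. Necessity is seen by interpolating the signs of a finite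
  piece of \<open>\<lambda>\<close>. Conversely, \<open>T\<close> maps the ball of radius \<open>K\<close> onto a convex set of bounded sequences
  that is compact for pointwise convergence, and a bounded sequence outside such a set is separated
  from it by some \<open>\<lambda> \<in> \<ell>\<^sub>1\<close>; hence every sequence in the unit ball of \<open>\<ell>\<^sub>\<infinity>\<close> is interpolated. So the
  admissible constants in (i) and (iv) coincide, they are the reciprocals of those in (ii), and
  their infimum is attained.

  For (iii), uniform separation and the lattice operations yield little Lipschitz functions that
  agree with a given \<open>f\<close> on a finite net, at the price of a factor \<open>a\<close> in the norm. Averaging a
  sequence of such functions chosen by a gliding hump removes this factor, and the average
  interpolates \<open>T f\<close> up to \<open>\<eta>\<close> when \<open>T f \<in> c\<^sub>0\<close>. Interpolating the unit sequences forces
  \<open>d(x\<^sub>n, y\<^sub>n) \<longlonglongrightarrow> 0\<close>, so \<open>T\<close> maps \<open>lip\<^sub>0\<close> into \<open>c\<^sub>0\<close>, and the error is removed by iteration, at an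
  arbitrarily small cost in the norm.
\<close>

section \<open>Separation of bounded sequences by \<open>\<ell>\<^sub>1\<close>\<close>

lemma
  assumes lam: "lam \<in> l1" and a: "\<And>n. \<bar>a n\<bar> \<le> K"
  shows summable_l1_mult: "summable (\<lambda>n. lam n * a n)"
    and abs_l1_pairing_le: "\<bar>\<Sum>n. lam n * a n\<bar> \<le> K * l1norm lam"
proof -
  have summable_lam: "summable (\<lambda>n. \<bar>lam n\<bar>)" using lam by (simp add: l1_def)
  have le: "\<bar>lam n * a n\<bar> \<le> K * \<bar>lam n\<bar>" for n
    using mult_right_mono[OF a[of n] abs_ge_zero[of "lam n"]] by (simp add: abs_mult mult.commute)
  have summable_abs: "summable (\<lambda>n. \<bar>lam n * a n\<bar>)"
    using le by (intro summable_comparison_test'[OF summable_mult[OF summable_lam, of K]]) auto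
  then show "summable (\<lambda>n. lam n * a n)" by (rule summable_rabs_cancel)
  have "\<bar>\<Sum>n. lam n * a n\<bar> \<le> (\<Sum>n. \<bar>lam n * a n\<bar>)" by (rule summable_rabs[OF summable_abs])
  also have "\<dots> \<le> (\<Sum>n. K * \<bar>lam n\<bar>)"
    by (rule suminf_le[OF le summable_abs summable_mult[OF summable_lam]])
  also have "\<dots> = K * l1norm lam" unfolding l1norm_def by (rule suminf_mult[OF summable_lam])
  finally show "\<bar>\<Sum>n. lam n * a n\<bar> \<le> K * l1norm lam" .
qed

lemma dyadic_mult_in_l1:
  assumes "\<And>n. \<bar>a n\<bar> \<le> K"
  shows "(\<lambda>n. (1/2)^n * a n) \<in> l1"
proof -
  have "summable (\<lambda>n. (1/2)^n * \<bar>a n\<bar>)"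
    using assms by (intro summable_l1_mult[of _ _ K]) (auto simp: l1_def power_abs)
  then show ?thesis by (simp add: l1_def abs_mult power_abs)
qed

definition dyadic_square_sum :: "(nat \<Rightarrow> real) \<Rightarrow> real" where
  "dyadic_square_sum a = (\<Sum>n. (1/2)^n * (a n)\<^sup>2)"

lemma summable_dyadic_product:
  fixes a b :: "nat \<Rightarrow> real"
  assumes "\<And>n. \<bar>a n\<bar> \<le> K" "\<And>n. \<bar>b n\<bar> \<le> L"
  shows "summable (\<lambda>n. (1/2)^n * a n * b n)"
  using summable_l1_mult[OF dyadic_mult_in_l1[of a, OF assms(1)] assms(2)] .

lemma dyadic_square_sum_pos:
  assumes "\<And>n. \<bar>a n\<bar> \<le> K" and "a m \<noteq> 0"
  shows "dyadic_square_sum a > 0"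
  unfolding dyadic_square_sum_def
proof (rule suminf_pos2[where i = m])
  show "summable (\<lambda>n. (1/2)^n * (a n)\<^sup>2)"
    using summable_dyadic_product[of a K a K] assms(1) by (simp add: power2_eq_square mult.assoc)
qed (use assms(2) in auto)

lemma dyadic_square_sum_diff:
  assumes "\<And>n. \<bar>a n\<bar> \<le> K" "\<And>n. \<bar>b n\<bar> \<le> L"
  shows "dyadic_square_sum (\<lambda>n. a n - t * b n)
    = dyadic_square_sum a - 2 * t * (\<Sum>n. (1/2)^n * a n * b n) + t\<^sup>2 * dyadic_square_sum b"
proof -
  have "(\<lambda>n. (1/2)^n * a n * a n - 2 * t * ((1/2)^n * a n * b n) + t\<^sup>2 * ((1/2)^n * b n * b n)) sums
    ((\<Sum>n. (1/2)^n * a n * a n) - 2 * t * (\<Sum>n. (1/2)^n * a n * b n)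
      + t\<^sup>2 * (\<Sum>n. (1/2)^n * b n * b n))"
    by (intro sums_add sums_diff sums_mult summable_sums summable_dyadic_product) (fact assms)+
  then show ?thesis
    unfolding dyadic_square_sum_def by (simp add: sums_iff power2_eq_square algebra_simps)
qed

lemma continuous_on_dyadic_square_sum:
  fixes a :: "'b::topological_space \<Rightarrow> nat \<Rightarrow> real"
  assumes "\<And>n. continuous_on C (\<lambda>u. a u n)" and "\<And>u n. u \<in> C \<Longrightarrow> \<bar>a u n\<bar> \<le> K"
  shows "continuous_on C (\<lambda>u. dyadic_square_sum (a u))"
  unfolding dyadic_square_sum_def
proof (rule uniform_limit_theorem)
  show "\<forall>\<^sub>F N in sequentially. continuous_on C (\<lambda>u. \<Sum>n<N. (1/2)^n * (a u n)\<^sup>2)"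
    by (intro always_eventually allI continuous_intros assms(1))
  show "uniform_limit C (\<lambda>N u. \<Sum>n<N. (1/2)^n * (a u n)\<^sup>2)
      (\<lambda>u. \<Sum>n. (1/2)^n * (a u n)\<^sup>2) sequentially"
  proof (rule Weierstrass_m_test)
    show "norm ((1/2)^n * (a u n)\<^sup>2) \<le> (1/2)^n * K\<^sup>2" if "u \<in> C" for n u
      using power_mono[OF assms(2)[OF that] abs_ge_zero, of n 2] by simp
    show "summable (\<lambda>n. (1/2)^n * K\<^sup>2)" by (intro summable_mult2 summable_geometric) auto
  qed
qed simp

lemma nonpos_if_le_small_multiples:
  fixes b c :: real
  assumes "\<And>t. 0 < t \<Longrightarrow> t < 1 \<Longrightarrow> b \<le> t * c"
  shows "b \<le> 0"
proof -
  have "s * c \<le> c - b" if "0 < s" "s < 1" for s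
    using assms[of "1 - s"] that by (simp add: algebra_simps)
  then have "c \<le> c - b" by (rule field_le_mult_one_interval)
  then show ?thesis by simp
qed

lemma nearest_point_variational_inequality:
  fixes C :: "(nat \<Rightarrow> real) set"
  assumes convex: "\<And>u v t. u \<in> C \<Longrightarrow> v \<in> C \<Longrightarrow> 0 \<le> t \<Longrightarrow> t \<le> 1 \<Longrightarrow>
      (\<lambda>n. (1 - t) * u n + t * v n) \<in> C"
    and C_bound: "\<And>u n. u \<in> C \<Longrightarrow> \<bar>u n\<bar> \<le> K" and \<alpha>_bound: "\<And>n. \<bar>\<alpha> n\<bar> \<le> L"
    and u: "u \<in> C" and v: "v \<in> C"
    and nearest: "\<And>w. w \<in> C \<Longrightarrow>
      dyadic_square_sum (\<lambda>n. \<alpha> n - u n) \<le> dyadic_square_sum (\<lambda>n. \<alpha> n - w n)"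
  shows "(\<Sum>n. (1/2)^n * (\<alpha> n - u n) * (v n - u n)) \<le> 0"
proof -
  let ?Q = "\<lambda>u. dyadic_square_sum (\<lambda>n. \<alpha> n - u n)"
  let ?b = "\<Sum>n. (1/2)^n * (\<alpha> n - u n) * (v n - u n)"
  let ?c = "dyadic_square_sum (\<lambda>n. v n - u n)"
  have residual_bound: "\<bar>\<alpha> n - u n\<bar> \<le> L + K" for n
    using \<alpha>_bound[of n] C_bound[OF u, of n] by linarith
  have diff_bound: "\<bar>v n - u n\<bar> \<le> K + K" for n
    using C_bound[OF v, of n] C_bound[OF u, of n] by linarith
  have "2 * ?b \<le> t * ?c" if t: "0 < t" "t < 1" for t
  proof -
    have "?Q u \<le> ?Q (\<lambda>n. (1 - t) * u n + t * v n)" using u v t by (intro nearest convex) auto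
    also have "\<dots> = dyadic_square_sum (\<lambda>n. (\<alpha> n - u n) - t * (v n - u n))"
      by (simp add: algebra_simps)
    also have "\<dots> = ?Q u - 2 * t * ?b + t\<^sup>2 * ?c"
      by (rule dyadic_square_sum_diff[OF residual_bound diff_bound])
    finally have "t * (2 * ?b) \<le> t * (t * ?c)" by (simp add: power2_eq_square algebra_simps)
    then show ?thesis using t by simp
  qed
  then have "2 * ?b \<le> 0" by (rule nonpos_if_le_small_multiples)
  then show ?thesis by simp
qed

text \<open>The separating functional is the residual of a best weighted least-squares approximation; the
  weights make it summable.\<close>

lemma l1_separation:
  fixes C :: "(nat \<Rightarrow> real) set"
  assumes "compact C" "C \<noteq> {}"
    and convex: "\<And>u v t. u \<in> C \<Longrightarrow> v \<in> C \<Longrightarrow> 0 \<le> t \<Longrightarrow> t \<le> 1 \<Longrightarrow> (\<lambda>n. (1 - t) * u n + t * v n) \<in> C"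
    and C_bound: "\<And>u n. u \<in> C \<Longrightarrow> \<bar>u n\<bar> \<le> K"
    and \<alpha>_bound: "\<And>n. \<bar>\<alpha> n\<bar> \<le> L" and "\<alpha> \<notin> C"
  obtains lam u where "lam \<in> l1" "u \<in> C"
    and "\<And>v. v \<in> C \<Longrightarrow> (\<Sum>n. lam n * v n) \<le> (\<Sum>n. lam n * u n)"
    and "(\<Sum>n. lam n * u n) < (\<Sum>n. lam n * \<alpha> n)"
proof -
  let ?Q = "\<lambda>u. dyadic_square_sum (\<lambda>n. \<alpha> n - u n)"
  have residual_bound: "\<bar>\<alpha> n - u n\<bar> \<le> L + K" if "u \<in> C" for u n
    using \<alpha>_bound[of n] C_bound[OF that, of n] by linarith
  have "continuous_on C ?Q"
    by (intro continuous_on_dyadic_square_sum[of _ _ "L + K"] residual_bound continuous_intros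
        continuous_on_subset[OF continuous_on_product_coordinates]) auto
  then obtain u where u: "u \<in> C" "\<And>v. v \<in> C \<Longrightarrow> ?Q u \<le> ?Q v"
    using continuous_attains_inf[OF assms(1,2)] by blast
  define lam where "lam n = (1/2)^n * (\<alpha> n - u n)" for n
  have lam: "lam \<in> l1" unfolding lam_def by (rule dyadic_mult_in_l1[OF residual_bound[OF u(1)]])
  have pairing_diff: "(\<Sum>n. lam n * (v n - w n)) = (\<Sum>n. lam n * v n) - (\<Sum>n. lam n * w n)"
    if "\<And>n. \<bar>v n\<bar> \<le> B" "\<And>n. \<bar>w n\<bar> \<le> B'" for v w B B'
    using suminf_diff[OF summable_l1_mult[OF lam that(1)] summable_l1_mult[OF lam that(2)]]
    by (simp add: right_diff_distrib)
  have optimal: "(\<Sum>n. lam n * v n) \<le> (\<Sum>n. lam n * u n)" if v: "v \<in> C" for v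
  proof -
    have "(\<Sum>n. (1/2)^n * (\<alpha> n - u n) * (v n - u n)) \<le> 0"
      by (rule nearest_point_variational_inequality[of C K \<alpha> L])
        (auto intro: convex C_bound \<alpha>_bound u v)
    then show ?thesis using pairing_diff[OF C_bound[OF v] C_bound[OF u(1)]] by (simp add: lam_def)
  qed
  obtain m where "\<alpha> m - u m \<noteq> 0" using u(1) \<open>\<alpha> \<notin> C\<close> by (metis eq_iff_diff_eq_0 ext)
  then have "0 < ?Q u" by (rule dyadic_square_sum_pos[OF residual_bound[OF u(1)]])
  also have "\<dots> = (\<Sum>n. lam n * (\<alpha> n - u n))"
    by (simp add: dyadic_square_sum_def lam_def power2_eq_square mult.assoc)
  finally have "(\<Sum>n. lam n * u n) < (\<Sum>n. lam n * \<alpha> n)"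
    unfolding pairing_diff[OF \<alpha>_bound C_bound[OF u(1)]] by simp
  with lam u(1) optimal show thesis by (rule that)
qed

section \<open>Balls of Lipschitz functions\<close>

definition lipball :: "'a::metric_space set \<Rightarrow> 'a \<Rightarrow> real \<Rightarrow> ('a \<Rightarrow> real) set" where
  "lipball X z K = {f. f z = 0 \<and> K-lipschitz_on X f}"

lemma lipballI:
  assumes "f z = 0" "\<And>x y. x \<in> X \<Longrightarrow> y \<in> X \<Longrightarrow> \<bar>f x - f y\<bar> \<le> K * dist x y" "0 \<le> K"
  shows "f \<in> lipball X z K"
  using assms by (auto simp: lipball_def dist_real_def intro!: lipschitz_onI)

lemma lipball_base: "f \<in> lipball X z K \<Longrightarrow> f z = 0"
  by (simp add: lipball_def)

lemma abs_diff_le_lipball: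
  "f \<in> lipball X z K \<Longrightarrow> x \<in> X \<Longrightarrow> y \<in> X \<Longrightarrow> \<bar>f x - f y\<bar> \<le> K * dist x y"
  using lipschitz_onD[of K X f x y] by (simp add: lipball_def dist_real_def)

lemma lipball_radius_nonneg: "f \<in> lipball X z K \<Longrightarrow> 0 \<le> K"
  using lipschitz_on_nonneg by (auto simp: lipball_def)

lemma zero_in_lipball: "0 \<le> K \<Longrightarrow> (\<lambda>_. 0) \<in> lipball X z K"
  by (rule lipballI) auto

lemma lipball_cmult: "f \<in> lipball X z K \<Longrightarrow> (\<lambda>x. c * f x) \<in> lipball X z (\<bar>c\<bar> * K)"
  by (auto simp: lipball_def intro: lipschitz_on_cmult_real)

lemma lipball_convex:
  assumes "f \<in> lipball X z K" "g \<in> lipball X z K" "0 \<le> t" "t \<le> 1"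
  shows "(\<lambda>x. (1 - t) * f x + t * g x) \<in> lipball X z K"
proof -
  have "((1 - t) * K + t * K)-lipschitz_on X (\<lambda>x. (1 - t) * f x + t * g x)"
    using assms by (intro lipschitz_on_add lipschitz_on_cmult_real_nonneg) (auto simp: lipball_def)
  then show ?thesis using assms by (simp add: lipball_def algebra_simps)
qed

lemma Lip0_iff_lipball: "f \<in> Lip0 X z \<longleftrightarrow> (\<exists>K. f \<in> lipball X z K)"
proof
  assume "f \<in> Lip0 X z"
  then obtain L where L: "f z = 0" "\<And>x y. x \<in> X \<Longrightarrow> y \<in> X \<Longrightarrow> \<bar>f x - f y\<bar> \<le> L * dist x y"
    by (auto simp: Lip0_def)
  have "f \<in> lipball X z \<bar>L\<bar>"
    using L order_trans[OF L(2) mult_right_mono[OF abs_ge_self zero_le_dist]]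
    by (intro lipballI) auto
  then show "\<exists>K. f \<in> lipball X z K" ..
next
  assume "\<exists>K. f \<in> lipball X z K"
  then obtain K where "f \<in> lipball X z K" ..
  then show "f \<in> Lip0 X z" unfolding Lip0_def using abs_diff_le_lipball lipball_base by blast
qed

lemma lipnorm_le_iff_lipball:
  assumes "p \<in> X" "q \<in> X" "p \<noteq> q"
  shows "f \<in> Lip0 X z \<and> lipnorm X f \<le> K \<longleftrightarrow> f \<in> lipball X z K"
proof -
  let ?P = "{(x, y). x \<in> X \<and> y \<in> X \<and> x \<noteq> y}"
  let ?q = "\<lambda>p. \<bar>f (fst p) - f (snd p)\<bar> / dist (fst p) (snd p)"
  have P: "(p, q) \<in> ?P" using assms by simp
  have quotient_le: "?q r \<le> L" if "f \<in> lipball X z L" "r \<in> ?P" for L r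
    using abs_diff_le_lipball[OF that(1), of "fst r" "snd r"] that(2)
    by (auto simp: pos_divide_le_eq)
  have bdd: "bdd_above (?q ` ?P)" if "f \<in> lipball X z L" for L
    using quotient_le[OF that] by (rule bdd_aboveI2)
  show ?thesis
  proof
    assume f: "f \<in> Lip0 X z \<and> lipnorm X f \<le> K"
    then have "bdd_above (?q ` ?P)" using bdd by (auto simp: Lip0_iff_lipball)
    then have le: "?q r \<le> K" if "r \<in> ?P" for r
      using cSUP_upper[OF that, of ?q] f unfolding lipnorm_def by linarith
    show "f \<in> lipball X z K"
    proof (rule lipballI)
      show "f z = 0" using f by (simp add: Lip0_def)
      show "0 \<le> K" by (rule order_trans[OF _ le[OF P]]) simp
      show "\<bar>f x - f y\<bar> \<le> K * dist x y" if "x \<in> X" "y \<in> X" for x y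
        using le[of "(x, y)"] that by (cases "x = y") (auto simp: pos_divide_le_eq)
    qed
  next
    assume f: "f \<in> lipball X z K"
    then have "lipnorm X f \<le> K"
      unfolding lipnorm_def using P quotient_le[OF f] by (intro cSUP_least) auto
    then show "f \<in> Lip0 X z \<and> lipnorm X f \<le> K" using f Lip0_iff_lipball by blast
  qed
qed

locale pointed_metric_subset =
  fixes X :: "'a::metric_space set" and z :: 'a
  assumes base_in: "z \<in> X"

lemma (in pointed_metric_subset) summable_lipball:
  assumes "\<And>k. g k \<in> lipball X z (c k)" "summable c" "x \<in> X"
  shows "summable (\<lambda>k. g k x)"
proof (rule summable_comparison_test')
  show "summable (\<lambda>k. c k * dist x z)" using assms(2) by (rule summable_mult2)
  show "norm (g k x) \<le> c k * dist x z" for k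
    using abs_diff_le_lipball[OF assms(1,3) base_in] lipball_base[OF assms(1)] by simp
qed

lemma (in pointed_metric_subset) lipball_suminf:
  assumes g: "\<And>k. g k \<in> lipball X z (c k)" and c: "summable c"
  shows "(\<lambda>x. \<Sum>k. g k x) \<in> lipball X z (suminf c)"
proof (rule lipballI)
  show "(\<Sum>k. g k z) = 0" using lipball_base[OF g] by simp
  show "0 \<le> suminf c" using c lipball_radius_nonneg[OF g] by (rule suminf_nonneg)
  fix x y assume xy: "x \<in> X" "y \<in> X"
  have "\<bar>(\<Sum>k. g k x) - (\<Sum>k. g k y)\<bar> = \<bar>\<Sum>k. g k x - g k y\<bar>"
    by (simp add: suminf_diff summable_lipball[OF g c] xy)
  also have "\<dots> \<le> (\<Sum>k. c k * dist x y)"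
    using norm_suminf_le[of "\<lambda>k. g k x - g k y", OF _ summable_mult2[OF c]]
      abs_diff_le_lipball[OF g xy] by simp
  also have "\<dots> = suminf c * dist x y" using suminf_mult2[OF c] by simp
  finally show "\<bar>(\<Sum>k. g k x) - (\<Sum>k. g k y)\<bar> \<le> suminf c * dist x y" .
qed

text \<open>Functions are total here, so compactness for pointwise convergence requires their irrelevant
  values outside \<open>X\<close> to be fixed.\<close>

lemma (in pointed_metric_subset) compact_lipball_restrict:
  "compact {f \<in> lipball X z K. \<forall>x. x \<notin> X \<longrightarrow> f x = 0}" (is "compact ?B")
proof -
  let ?P = "PiE UNIV (\<lambda>x. {- \<bar>K * dist x z\<bar> .. \<bar>K * dist x z\<bar>})"
  have "compactin (product_topology (\<lambda>_. euclidean) UNIV) ?P"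
    by (subst compactin_PiE) auto
  then have compact_P: "compact ?P" by (simp add: euclidean_product_topology)
  have closed_B: "closed ?B"
  proof -
    have "?B = {f. f z = 0} \<inter> {f. 0 \<le> K} \<inter> (\<Inter>x\<in>X. \<Inter>y\<in>X. {f. dist (f x) (f y) \<le> K * dist x y})
        \<inter> (\<Inter>x\<in>-X. {f. f x = 0})"
      by (auto simp: lipball_def lipschitz_on_def)
    also have "closed \<dots>"
      by (intro closed_Int closed_INT ballI closed_Collect_le closed_Collect_eq
          continuous_intros) auto
    finally show ?thesis .
  qed
  have "?B \<subseteq> ?P"
  proof
    fix f assume f: "f \<in> ?B"
    have "\<bar>f x\<bar> \<le> \<bar>K * dist x z\<bar>" for x
      using f abs_diff_le_lipball[of f X z K x z] lipball_base[of f X z K] base_in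
      by (cases "x \<in> X") auto
    then show "f \<in> ?P" by (auto simp: abs_le_iff minus_le_iff)
  qed
  then show ?thesis using compact_Int_closed[OF compact_P closed_B] by (simp only: Int_absorb1)
qed

section \<open>Little Lipschitz functions\<close>

definition little_lipschitz_on :: "'a::metric_space set \<Rightarrow> ('a \<Rightarrow> real) \<Rightarrow> bool" where
  "little_lipschitz_on X f \<longleftrightarrow>
    (\<lambda>p. f (fst p) - f (snd p)) \<in> o[uniformity_on X](\<lambda>p. dist (fst p) (snd p))"

lemma little_lipschitz_on_iff:
  "little_lipschitz_on X f \<longleftrightarrow>
    (\<forall>e>0. \<exists>d>0. \<forall>x\<in>X. \<forall>y\<in>X. dist x y < d \<longrightarrow> \<bar>f x - f y\<bar> \<le> e * dist x y)"
  unfolding little_lipschitz_on_def smallo_def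
  by (simp add: eventually_inf_principal eventually_uniformity_metric)
    (intro all_cong1 imp_cong ex_cong1 conj_cong refl; blast)

lemma lip0_iff: "f \<in> lip0 X z \<longleftrightarrow> f \<in> Lip0 X z \<and> little_lipschitz_on X f"
proof -
  have "(\<forall>e>0. \<exists>d>0. \<forall>x\<in>X. \<forall>y\<in>X. 0 < dist x y \<and> dist x y < d \<longrightarrow> \<bar>f x - f y\<bar> / dist x y < e)
      \<longleftrightarrow> little_lipschitz_on X f" (is "?lip0 \<longleftrightarrow> _")
    unfolding little_lipschitz_on_iff
  proof (intro iffI allI impI)
    fix e :: real assume ?lip0 "e > 0"
    then obtain d where "d > 0" and
      d: "\<forall>x\<in>X. \<forall>y\<in>X. 0 < dist x y \<and> dist x y < d \<longrightarrow> \<bar>f x - f y\<bar> / dist x y < e"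
      by blast
    have "\<bar>f x - f y\<bar> \<le> e * dist x y" if "x \<in> X" "y \<in> X" "dist x y < d" for x y
      using d[rule_format, of x y] that by (cases "x = y") (simp_all add: pos_divide_less_eq)
    with \<open>d > 0\<close> show "\<exists>d>0. \<forall>x\<in>X. \<forall>y\<in>X. dist x y < d \<longrightarrow> \<bar>f x - f y\<bar> \<le> e * dist x y" by blast
  next
    fix e :: real
    assume "\<forall>e>0. \<exists>d>0. \<forall>x\<in>X. \<forall>y\<in>X. dist x y < d \<longrightarrow> \<bar>f x - f y\<bar> \<le> e * dist x y" and "e > 0"
    then obtain d where "d > 0" and
      d: "\<forall>x\<in>X. \<forall>y\<in>X. dist x y < d \<longrightarrow> \<bar>f x - f y\<bar> \<le> e / 2 * dist x y"
      by (meson half_gt_zero)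
    have "\<bar>f x - f y\<bar> / dist x y < e" if "x \<in> X" "y \<in> X" "0 < dist x y" "dist x y < d" for x y
    proof -
      have "\<bar>f x - f y\<bar> / dist x y \<le> e / 2"
        using d that by (simp add: pos_divide_le_eq)
      then show ?thesis using \<open>e > 0\<close> by linarith
    qed
    with \<open>d > 0\<close>
    show "\<exists>d>0. \<forall>x\<in>X. \<forall>y\<in>X. 0 < dist x y \<and> dist x y < d \<longrightarrow> \<bar>f x - f y\<bar> / dist x y < e" by blast
  qed
  then show ?thesis by (simp add: lip0_def)
qed

lemma little_lipschitz_on_cmult:
  "little_lipschitz_on X f \<Longrightarrow> little_lipschitz_on X (\<lambda>x. c * f x)"
  by (cases "c = 0") (simp_all add: little_lipschitz_on_def flip: right_diff_distrib)

lemma little_lipschitz_on_add_const_iff: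
  "little_lipschitz_on X (\<lambda>x. c + f x) \<longleftrightarrow> little_lipschitz_on X f"
  by (simp add: little_lipschitz_on_def)

lemma little_lipschitz_on_sum:
  assumes "\<And>k. k \<in> I \<Longrightarrow> little_lipschitz_on X (g k)"
  shows "little_lipschitz_on X (\<lambda>x. \<Sum>k\<in>I. g k x)"
  using assms unfolding little_lipschitz_on_def sum_subtractf[symmetric] by (rule big_sum_in_smallo)

lemma (in pointed_metric_subset) little_lipschitz_on_suminf:
  assumes g: "\<And>k. g k \<in> lipball X z (c k)" "\<And>k. little_lipschitz_on X (g k)"
    and c: "summable c"
  shows "little_lipschitz_on X (\<lambda>x. \<Sum>k. g k x)"
  unfolding little_lipschitz_on_iff
proof (intro allI impI)
  fix e :: real assume "e > 0"
  then have "e / 2 > 0" by simp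
  then obtain m where m: "\<bar>\<Sum>k. c (k + m)\<bar> < e / 2" using suminf_exist_split[OF _ c] by fastforce
  have tail: "(\<lambda>x. \<Sum>k. g (k + m) x) \<in> lipball X z (\<Sum>k. c (k + m))"
    using c by (intro lipball_suminf g summable_ignore_initial_segment)
  obtain d where d: "d > 0" "\<forall>x\<in>X. \<forall>y\<in>X. dist x y < d \<longrightarrow>
      \<bar>(\<Sum>k<m. g k x) - (\<Sum>k<m. g k y)\<bar> \<le> e / 2 * dist x y"
    using little_lipschitz_on_sum[of "{..<m}" X g, OF g(2)] \<open>e / 2 > 0\<close>
    unfolding little_lipschitz_on_iff by blast
  have "\<bar>(\<Sum>k. g k x) - (\<Sum>k. g k y)\<bar> \<le> e * dist x y"
    if xy: "x \<in> X" "y \<in> X" "dist x y < d" for x y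
  proof -
    have split: "(\<Sum>k. g k t) = (\<Sum>k. g (k + m) t) + (\<Sum>k<m. g k t)" if "t \<in> X" for t
      using that by (intro suminf_split_initial_segment summable_lipball[OF g(1) c])
    have "\<bar>(\<Sum>k. g (k + m) x) - (\<Sum>k. g (k + m) y)\<bar> \<le> e / 2 * dist x y"
      using abs_diff_le_lipball[OF tail xy(1,2)] m
      by (intro order_trans[OF _ mult_right_mono[of "\<Sum>k. c (k + m)" "e / 2"]]) auto
    then show ?thesis
      using d(2)[rule_format, OF xy] unfolding split[OF xy(1)] split[OF xy(2)] by argo
  qed
  with d(1) show "\<exists>d>0. \<forall>x\<in>X. \<forall>y\<in>X. dist x y < d \<longrightarrow> \<bar>(\<Sum>k. g k x) - (\<Sum>k. g k y)\<bar> \<le> e * dist x y"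
    by blast
qed

section \<open>Finite maxima and minima\<close>

lemma Max_image_le_add:
  fixes u v :: "'b \<Rightarrow> real"
  assumes "finite A" "A \<noteq> {}" "\<And>i. i \<in> A \<Longrightarrow> u i \<le> v i + e"
  shows "Max (u ` A) \<le> Max (v ` A) + e"
proof -
  have "u i \<le> Max (v ` A) + e" if "i \<in> A" for i
  proof -
    have "v i \<le> Max (v ` A)" using that \<open>finite A\<close> by simp
    then show ?thesis using assms(3)[OF that] by linarith
  qed
  then show ?thesis using assms by simp
qed

lemma abs_Max_diff_le:
  fixes u v :: "'b \<Rightarrow> real"
  assumes "finite A" "A \<noteq> {}" "\<And>i. i \<in> A \<Longrightarrow> \<bar>u i - v i\<bar> \<le> e"
  shows "\<bar>Max (u ` A) - Max (v ` A)\<bar> \<le> e"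
  using Max_image_le_add[of A u v e] Max_image_le_add[of A v u e] assms
  by (fastforce simp: abs_le_iff)

lemma Min_image_eq_uminus_Max:
  fixes u :: "'b \<Rightarrow> real"
  assumes "finite A" "A \<noteq> {}"
  shows "Min (u ` A) = - Max ((\<lambda>i. - u i) ` A)"
  using minus_Min_eq_Max[of "u ` A"] assms by (simp add: image_image)

lemma lipschitz_on_Max:
  fixes F :: "'b \<Rightarrow> 'a::metric_space \<Rightarrow> real"
  assumes "finite A" "A \<noteq> {}" "\<And>i. i \<in> A \<Longrightarrow> K-lipschitz_on X (F i)"
  shows "K-lipschitz_on X (\<lambda>x. Max ((\<lambda>i. F i x) ` A))"
proof (rule lipschitz_onI)
  show "0 \<le> K" using assms lipschitz_on_nonneg by blast
  show "dist (Max ((\<lambda>i. F i x) ` A)) (Max ((\<lambda>i. F i y) ` A)) \<le> K * dist x y"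
    if "x \<in> X" "y \<in> X" for x y
    using abs_Max_diff_le[OF assms(1,2)] lipschitz_onD[OF assms(3) that]
    by (simp add: dist_real_def)
qed

lemma little_lipschitz_on_Max:
  fixes F :: "'b \<Rightarrow> 'a::metric_space \<Rightarrow> real"
  assumes "finite A" "A \<noteq> {}" "\<And>i. i \<in> A \<Longrightarrow> little_lipschitz_on X (F i)"
  shows "little_lipschitz_on X (\<lambda>x. Max ((\<lambda>i. F i x) ` A))"
  unfolding little_lipschitz_on_def
proof (rule landau_o.smallI)
  fix c :: real assume "c > 0"
  then have "\<forall>\<^sub>F p in uniformity_on X. \<forall>i\<in>A. \<bar>F i (fst p) - F i (snd p)\<bar> \<le> c * dist (fst p) (snd p)"
    using assms landau_o.smallD[OF _ \<open>c > 0\<close>] unfolding little_lipschitz_on_def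
    by (intro eventually_ball_finite) fastforce+
  then show "\<forall>\<^sub>F p in uniformity_on X.
      norm (Max ((\<lambda>i. F i (fst p)) ` A) - Max ((\<lambda>i. F i (snd p)) ` A))
      \<le> c * norm (dist (fst p) (snd p))"
    by eventually_elim (use assms in \<open>auto intro!: abs_Max_diff_le\<close>)
qed

lemma lipschitz_on_Min:
  fixes F :: "'b \<Rightarrow> 'a::metric_space \<Rightarrow> real"
  assumes "finite A" "A \<noteq> {}" "\<And>i. i \<in> A \<Longrightarrow> K-lipschitz_on X (F i)"
  shows "K-lipschitz_on X (\<lambda>x. Min ((\<lambda>i. F i x) ` A))"
  unfolding Min_image_eq_uminus_Max[OF assms(1,2)] using assms
  by (intro lipschitz_on_minus lipschitz_on_Max)

lemma little_lipschitz_on_Min: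
  fixes F :: "'b \<Rightarrow> 'a::metric_space \<Rightarrow> real"
  assumes "finite A" "A \<noteq> {}" "\<And>i. i \<in> A \<Longrightarrow> little_lipschitz_on X (F i)"
  shows "little_lipschitz_on X (\<lambda>x. Min ((\<lambda>i. F i x) ` A))"
  unfolding Min_image_eq_uminus_Max[OF assms(1,2)]
  using little_lipschitz_on_Max[OF assms(1,2), of X "\<lambda>i x. - F i x"]
    little_lipschitz_on_cmult[of X _ "-1"] assms(3)
  by simp

text \<open>The max-min formula of the lattice version of the Stone-Weierstrass theorem.\<close>

lemma Max_Min_interpolates:
  fixes H :: "'b \<Rightarrow> 'b \<Rightarrow> 'b \<Rightarrow> real"
  assumes A: "finite A" "t \<in> A"
    and H: "\<And>x y. x \<in> A \<Longrightarrow> y \<in> A \<Longrightarrow> H x y x = f x \<and> H x y y = f y"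
  shows "Max ((\<lambda>x. Min ((\<lambda>y. H x y t) ` A)) ` A) = f t"
proof (rule Max_eqI)
  show "finite ((\<lambda>x. Min ((\<lambda>y. H x y t) ` A)) ` A)" using A by simp
  have "(\<lambda>y. H t y t) ` A = {f t}" using A H by auto
  then show "f t \<in> (\<lambda>x. Min ((\<lambda>y. H x y t) ` A)) ` A"
    using A by (intro image_eqI[of _ _ t]) auto
  fix u assume "u \<in> (\<lambda>x. Min ((\<lambda>y. H x y t) ` A)) ` A"
  then obtain x where x: "x \<in> A" "u = Min ((\<lambda>y. H x y t) ` A)" by blast
  have "u \<le> H x t t" unfolding x(2) using A by (intro Min_le) auto
  then show "u \<le> f t" using H x A by simp
qed

section \<open>Approximation by little Lipschitz functions\<close>

lemma abs_diff_le_of_agree_on_net: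
  fixes f g :: "'a::metric_space \<Rightarrow> real"
  assumes f: "K-lipschitz_on X f" and g: "L-lipschitz_on X g"
    and A: "A \<subseteq> X" "\<And>t. t \<in> A \<Longrightarrow> g t = f t" and net: "X \<subseteq> (\<Union>t\<in>A. ball t r)" and x: "x \<in> X"
  shows "\<bar>g x - f x\<bar> \<le> (L + K) * r"
proof -
  obtain t where t: "t \<in> A" "dist x t < r" using net x by (auto simp: dist_commute)
  have diff: "(L + K)-lipschitz_on X (\<lambda>x. g x - f x)" using g f by (rule lipschitz_on_diff)
  have "\<bar>g x - f x\<bar> = dist (g x - f x) (g t - f t)" using A(2)[OF t(1)] by (simp add: dist_real_def)
  also have "\<dots> \<le> (L + K) * dist x t" using lipschitz_onD[OF diff x] t A(1) by blast
  also have "\<dots> \<le> (L + K) * r" using t lipschitz_on_nonneg[OF diff] by (intro mult_left_mono) auto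
  finally show ?thesis .
qed

lemma decseq_all_but_one_outside_gap:
  fixes \<delta> :: "nat \<Rightarrow> 'b::linorder"
  assumes "decseq \<delta>"
  shows "\<exists>j. \<forall>k. k \<noteq> j \<longrightarrow> \<delta> k \<le> D \<or> D < \<delta> (Suc k)"
proof (intro exI allI impI)
  define j where "j = (LEAST k. \<delta> (Suc k) \<le> D)"
  fix k assume "k \<noteq> j"
  show "\<delta> k \<le> D \<or> D < \<delta> (Suc k)"
  proof (cases "\<delta> (Suc k) \<le> D")
    case True
    then have "\<delta> (Suc j) \<le> D" "j \<le> k" unfolding j_def by (auto intro: LeastI Least_le)
    then show ?thesis using decseqD[OF assms, of "Suc j" k] \<open>k \<noteq> j\<close> by force
  qed auto
qed

lemma abs_mean_le_all_but_one:
  fixes v :: "nat \<Rightarrow> real"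
  assumes "\<And>k. k \<noteq> j \<Longrightarrow> \<bar>v k\<bar> \<le> b" "\<bar>v j\<bar> \<le> b + c" "c \<ge> 0" "N > 0"
  shows "\<bar>(\<Sum>k<N. v k) / N\<bar> \<le> b + c / N"
proof -
  have "\<bar>\<Sum>k<N. v k\<bar> \<le> (\<Sum>k<N. \<bar>v k\<bar>)" by (rule sum_abs)
  also have "\<dots> \<le> (\<Sum>k<N. b + (if k = j then c else 0))"
    using assms by (intro sum_mono) auto
  also have "\<dots> = N * b + (if j < N then c else 0)" by (simp add: sum.distrib sum.delta)
  also have "\<dots> \<le> N * b + c" using \<open>c \<ge> 0\<close> by simp
  finally show ?thesis using \<open>N > 0\<close> by (simp add: field_simps)
qed

lemma abs_mean_lipball_diff_le:
  assumes g: "\<And>k::nat. g k \<in> lipball X z C" and xy: "x \<in> X" "y \<in> X"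
    and le: "\<And>k. k \<noteq> j \<Longrightarrow> \<bar>g k x - g k y\<bar> \<le> b" and "b \<ge> 0" "N > 0"
  shows "\<bar>(\<Sum>k<N. g k x - g k y) / N\<bar> \<le> b + C / N * dist x y"
proof -
  have "\<bar>(\<Sum>k<N. g k x - g k y) / N\<bar> \<le> b + C * dist x y / N"
  proof (rule abs_mean_le_all_but_one[OF le])
    show "\<bar>g j x - g j y\<bar> \<le> b + C * dist x y"
      using abs_diff_le_lipball[OF g xy] \<open>b \<ge> 0\<close> by (simp add: add_increasing)
  qed (use lipball_radius_nonneg[OF g] \<open>N > 0\<close> in auto)
  then show ?thesis by simp
qed

lemma ex_nat_divide_le:
  fixes c e :: real
  assumes "e > 0"
  obtains N :: nat where "N > 0" "c / N \<le> e"
proof -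
  obtain N :: nat where N: "\<bar>c\<bar> / e < N" using reals_Archimedean2 by blast
  moreover have "0 \<le> \<bar>c\<bar> / e" using \<open>e > 0\<close> by simp
  ultimately have "N > 0" by linarith
  moreover have "c / N \<le> e"
    using N \<open>N > 0\<close> \<open>e > 0\<close> by (simp add: pos_divide_less_eq pos_divide_le_eq mult.commute)
  ultimately show thesis by (rule that)
qed

locale little_lipschitz_separation = pointed_metric_subset X z
  for X :: "'a::metric_space set" and z +
  fixes a :: real
  assumes separation: "\<And>x y. x \<in> X \<Longrightarrow> y \<in> X \<Longrightarrow>
      \<exists>h\<in>lipball X z a. little_lipschitz_on X h \<and> \<bar>h x - h y\<bar> = dist x y"
begin

lemma separation_constant_nonneg: "0 \<le> a"
  using separation[OF base_in base_in] lipball_radius_nonneg by blast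

lemma little_lipschitz_interpolates_two_points:
  assumes "x \<in> X" "y \<in> X" and K: "\<bar>f x - f y\<bar> \<le> K * dist x y" "0 \<le> K"
  obtains h where "(K * a)-lipschitz_on X h" "little_lipschitz_on X h" "h x = f x" "h y = f y"
proof -
  obtain h where h: "h \<in> lipball X z a" "little_lipschitz_on X h" "\<bar>h x - h y\<bar> = dist x y"
    using separation assms by blast
  define c where "c = (f x - f y) / (h x - h y)"
  define g where "g = (\<lambda>t. (f y - c * h y) + c * h t)"
  have "\<bar>c\<bar> \<le> K" using K h(3) by (cases "x = y") (auto simp: c_def pos_divide_le_eq)
  then have "(0 + K * a)-lipschitz_on X g"
    unfolding g_def using h(1)
    by (intro lipschitz_on_add lipschitz_on_constant lipschitz_on_cmult_real_upper)
      (auto simp: lipball_def)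
  moreover have "little_lipschitz_on X g"
    unfolding g_def using h(2)
    by (simp add: little_lipschitz_on_add_const_iff little_lipschitz_on_cmult)
  moreover have "c * (h x - h y) = f x - f y" using h(3) by (cases "x = y") (auto simp: c_def)
  then have "g x = f x" "g y = f y" by (simp_all add: g_def algebra_simps)
  ultimately show thesis by (intro that[of g]) auto
qed

lemma little_lipschitz_interpolates_finite_set:
  assumes f: "f \<in> lipball X z K" and A: "finite A" "A \<subseteq> X" "z \<in> A"
  obtains g where "g \<in> lipball X z (K * a)" "little_lipschitz_on X g" "\<And>t. t \<in> A \<Longrightarrow> g t = f t"
proof -
  have "\<exists>h. (K * a)-lipschitz_on X h \<and> little_lipschitz_on X h \<and> h x = f x \<and> h y = f y"
    if "x \<in> A" "y \<in> A" for x y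
    using little_lipschitz_interpolates_two_points[of x y f K] abs_diff_le_lipball[OF f]
      lipball_radius_nonneg[OF f] that A(2) by (metis subsetD)
  then obtain H where H: "\<And>x y. x \<in> A \<Longrightarrow> y \<in> A \<Longrightarrow>
      (K * a)-lipschitz_on X (H x y) \<and> little_lipschitz_on X (H x y)
      \<and> H x y x = f x \<and> H x y y = f y"
    by metis
  define g where "g t = Max ((\<lambda>x. Min ((\<lambda>y. H x y t) ` A)) ` A)" for t
  have ne: "A \<noteq> {}" using A(3) by blast
  have interp: "g t = f t" if "t \<in> A" for t
    unfolding g_def using A(1) that H by (intro Max_Min_interpolates) auto
  have "(K * a)-lipschitz_on X g"
    unfolding g_def using H by (intro lipschitz_on_Max lipschitz_on_Min A(1) ne) auto
  then have "g \<in> lipball X z (K * a)"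
    using interp[OF A(3)] lipball_base[OF f] by (simp add: lipball_def)
  moreover have "little_lipschitz_on X g"
    unfolding g_def using H by (intro little_lipschitz_on_Max little_lipschitz_on_Min A(1) ne) auto
  ultimately show thesis using interp by (rule that)
qed

lemma little_lipschitz_close_off_diagonal:
  assumes "compact X" and f: "f \<in> lipball X z K" and "d > 0" "e > 0"
  obtains g where "g \<in> lipball X z (K * a)" "little_lipschitz_on X g"
    and "\<And>x y. x \<in> X \<Longrightarrow> y \<in> X \<Longrightarrow> d \<le> dist x y \<Longrightarrow> \<bar>(g x - g y) - (f x - f y)\<bar> \<le> e * dist x y"
proof -
  define L where "L = K * a + K"
  have L: "0 \<le> L" using lipball_radius_nonneg[OF f] separation_constant_nonneg by (simp add: L_def)
  define r where "r = e * d / (2 * (L + 1))"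
  have "r > 0" using L \<open>d > 0\<close> \<open>e > 0\<close> by (simp add: r_def)
  have Lr: "2 * (L * r) \<le> e * d"
  proof -
    have "2 * (L * r) \<le> 2 * (L + 1) * r" using \<open>r > 0\<close> by simp
    also have "\<dots> = e * d" using L by (simp add: r_def add_eq_0_iff_both_eq_0)
    finally show ?thesis .
  qed
  obtain A where A: "finite A" "A \<subseteq> X" "X \<subseteq> (\<Union>t\<in>A. ball t r)"
    using compactE_image[OF \<open>compact X\<close>, of X "\<lambda>x. ball x r"] \<open>r > 0\<close> by force
  obtain g where g: "g \<in> lipball X z (K * a)" "little_lipschitz_on X g"
      "\<And>t. t \<in> insert z A \<Longrightarrow> g t = f t"
    using little_lipschitz_interpolates_finite_set[OF f, of "insert z A"] A base_in by blast
  have close: "\<bar>g x - f x\<bar> \<le> L * r" if "x \<in> X" for x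
    unfolding L_def using f g A that
    by (intro abs_diff_le_of_agree_on_net[of K X f "K * a" g A r]) (auto simp: lipball_def)
  have "\<bar>(g x - g y) - (f x - f y)\<bar> \<le> e * dist x y" if "x \<in> X" "y \<in> X" "d \<le> dist x y" for x y
  proof -
    have "\<bar>(g x - g y) - (f x - f y)\<bar> \<le> e * d"
      using close[OF that(1)] close[OF that(2)] Lr by linarith
    also have "\<dots> \<le> e * dist x y" using that \<open>e > 0\<close> by simp
    finally show ?thesis .
  qed
  with g(1,2) show thesis by (rule that)
qed

lemma little_lipschitz_close_off_diagonal_flat_near_diagonal:
  assumes "compact X" "f \<in> lipball X z K" "s > 0" "e > 0"
  shows "\<exists>g s'. 0 < s' \<and> s' \<le> s \<and> g \<in> lipball X z (K * a) \<and> little_lipschitz_on X g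
    \<and> (\<forall>x\<in>X. \<forall>y\<in>X. s \<le> dist x y \<longrightarrow> \<bar>(g x - g y) - (f x - f y)\<bar> \<le> e * dist x y)
    \<and> (\<forall>x\<in>X. \<forall>y\<in>X. dist x y < s' \<longrightarrow> \<bar>g x - g y\<bar> \<le> e * dist x y)"
proof -
  obtain g where g: "g \<in> lipball X z (K * a)" "little_lipschitz_on X g"
    "\<And>x y. x \<in> X \<Longrightarrow> y \<in> X \<Longrightarrow> s \<le> dist x y \<Longrightarrow> \<bar>(g x - g y) - (f x - f y)\<bar> \<le> e * dist x y"
    using little_lipschitz_close_off_diagonal[OF assms] by blast
  obtain s' where "s' > 0" "\<forall>x\<in>X. \<forall>y\<in>X. dist x y < s' \<longrightarrow> \<bar>g x - g y\<bar> \<le> e * dist x y"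
    using g(2) \<open>e > 0\<close> unfolding little_lipschitz_on_iff by blast
  then show ?thesis using g \<open>s > 0\<close> by (intro exI[of _ g] exI[of _ "min s s'"]) auto
qed

text \<open>At any given scale all but one of the \<open>g k\<close> are either nearly flat or close to \<open>f\<close>.\<close>

lemma gliding_hump:
  assumes "compact X" and f: "f \<in> lipball X z K" and "d > 0" "e > 0"
  obtains g :: "nat \<Rightarrow> 'a \<Rightarrow> real"
  where "\<And>k. g k \<in> lipball X z (K * a)" "\<And>k. little_lipschitz_on X (g k)"
    and "\<And>k x y. x \<in> X \<Longrightarrow> y \<in> X \<Longrightarrow> d \<le> dist x y \<Longrightarrow>
      \<bar>(g k x - g k y) - (f x - f y)\<bar> \<le> e * dist x y"
    and "\<And>x y. x \<in> X \<Longrightarrow> y \<in> X \<Longrightarrow>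
      \<exists>j. \<forall>k. k \<noteq> j \<longrightarrow> \<bar>g k x - g k y\<bar> \<le> \<bar>f x - f y\<bar> + e * dist x y"
proof -
  define hump where "hump s s' g \<longleftrightarrow> g \<in> lipball X z (K * a) \<and> little_lipschitz_on X g
      \<and> (\<forall>x\<in>X. \<forall>y\<in>X. s \<le> dist x y \<longrightarrow> \<bar>(g x - g y) - (f x - f y)\<bar> \<le> e * dist x y)
      \<and> (\<forall>x\<in>X. \<forall>y\<in>X. dist x y < s' \<longrightarrow> \<bar>g x - g y\<bar> \<le> e * dist x y)" for s s' g
  have "\<exists>s'. (0 < s' \<and> s' \<le> d) \<and> s' \<le> s \<and> (\<exists>g. hump s s' g)" if "0 < s \<and> s \<le> d" for s
    using little_lipschitz_close_off_diagonal_flat_near_diagonal[OF \<open>compact X\<close> f _ \<open>e > 0\<close>, of s]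
      that unfolding hump_def by (meson order_trans)
  then have "\<exists>\<delta>. \<forall>k::nat. (0 < \<delta> k \<and> \<delta> k \<le> d) \<and> \<delta> (Suc k) \<le> \<delta> k \<and> (\<exists>g. hump (\<delta> k) (\<delta> (Suc k)) g)"
    using \<open>d > 0\<close> by (intro dependent_nat_choice) auto
  then obtain \<delta> g where \<delta>: "\<And>k::nat. \<delta> k \<le> d" "\<And>k. \<delta> (Suc k) \<le> \<delta> k"
    and "\<And>k. hump (\<delta> k) (\<delta> (Suc k)) (g k)" by metis
  then have g: "\<And>k. g k \<in> lipball X z (K * a)" "\<And>k. little_lipschitz_on X (g k)"
    and close: "\<And>k x y. x \<in> X \<Longrightarrow> y \<in> X \<Longrightarrow> \<delta> k \<le> dist x y \<Longrightarrow>
      \<bar>(g k x - g k y) - (f x - f y)\<bar> \<le> e * dist x y"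
    and flat: "\<And>k x y. x \<in> X \<Longrightarrow> y \<in> X \<Longrightarrow> dist x y < \<delta> (Suc k) \<Longrightarrow>
      \<bar>g k x - g k y\<bar> \<le> e * dist x y"
    by (auto simp: hump_def)
  have "\<exists>j. \<forall>k. k \<noteq> j \<longrightarrow> \<bar>g k x - g k y\<bar> \<le> \<bar>f x - f y\<bar> + e * dist x y"
    if xy: "x \<in> X" "y \<in> X" for x y
  proof -
    obtain j where j: "\<And>k. k \<noteq> j \<Longrightarrow> \<delta> k \<le> dist x y \<or> dist x y < \<delta> (Suc k)"
      using decseq_all_but_one_outside_gap[OF decseq_SucI[of \<delta>, OF \<delta>(2)], of "dist x y"] by blast
    have "\<bar>g k x - g k y\<bar> \<le> \<bar>f x - f y\<bar> + e * dist x y" if "k \<noteq> j" for k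
      using j[OF that] close[OF xy, of k] flat[OF xy, of k] by linarith
    then show ?thesis by blast
  qed
  with g show thesis using close order_trans[OF \<delta>(1)] by (intro that) auto
qed

text \<open>Averaging the functions of a gliding hump brings the Lipschitz constant back from \<open>K * a\<close>
  to almost \<open>K\<close>.\<close>

lemma little_lipschitz_approximation:
  assumes "compact X" and f: "f \<in> lipball X z K" and "d > 0" "e > 0"
  obtains g where "g z = 0" "little_lipschitz_on X g"
    and "\<And>x y. x \<in> X \<Longrightarrow> y \<in> X \<Longrightarrow> \<bar>g x - g y\<bar> \<le> \<bar>f x - f y\<bar> + e * dist x y"
    and "\<And>x y. x \<in> X \<Longrightarrow> y \<in> X \<Longrightarrow> d \<le> dist x y \<Longrightarrow> \<bar>(g x - g y) - (f x - f y)\<bar> \<le> e * dist x y"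
proof -
  obtain g :: "nat \<Rightarrow> 'a \<Rightarrow> real"
    where g: "\<And>k. g k \<in> lipball X z (K * a)" "\<And>k. little_lipschitz_on X (g k)"
    and close: "\<And>k x y. x \<in> X \<Longrightarrow> y \<in> X \<Longrightarrow> d \<le> dist x y \<Longrightarrow>
      \<bar>(g k x - g k y) - (f x - f y)\<bar> \<le> e / 2 * dist x y"
    and hump: "\<And>x y. x \<in> X \<Longrightarrow> y \<in> X \<Longrightarrow>
      \<exists>j. \<forall>k. k \<noteq> j \<longrightarrow> \<bar>g k x - g k y\<bar> \<le> \<bar>f x - f y\<bar> + e / 2 * dist x y"
    using gliding_hump[OF \<open>compact X\<close> f \<open>d > 0\<close>, of "e / 2"] \<open>e > 0\<close> by auto
  obtain N :: nat where N: "N > 0" and KaN: "K * a / N \<le> e / 2"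
    using ex_nat_divide_le[of "e / 2" "K * a"] \<open>e > 0\<close> by auto
  define G where "G x = 1 / N * (\<Sum>k<N. g k x)" for x
  have mean: "(G x - G y) - c = (\<Sum>k<N. (g k x - g k y) - c) / N" for x y c
    using N by (simp add: G_def sum_subtractf diff_divide_distrib)
  show thesis
  proof (rule that)
    show "G z = 0" using lipball_base[OF g(1)] by (simp add: G_def)
    show "little_lipschitz_on X G"
      unfolding G_def using g(2) by (intro little_lipschitz_on_cmult little_lipschitz_on_sum)
  next
    fix x y assume xy: "x \<in> X" "y \<in> X"
    obtain j where j: "\<And>k. k \<noteq> j \<Longrightarrow> \<bar>g k x - g k y\<bar> \<le> \<bar>f x - f y\<bar> + e / 2 * dist x y"
      using hump[OF xy] by blast
    have "\<bar>(\<Sum>k<N. g k x - g k y) / N\<bar> \<le> (\<bar>f x - f y\<bar> + e / 2 * dist x y) + K * a / N * dist x y"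
      using N \<open>e > 0\<close> by (intro abs_mean_lipball_diff_le[OF g(1) xy j]) auto
    moreover have "G x - G y = (\<Sum>k<N. g k x - g k y) / N" using mean[of x y 0] by simp
    moreover have "K * a / N * dist x y \<le> e / 2 * dist x y"
      using KaN zero_le_dist by (rule mult_right_mono)
    ultimately show "\<bar>G x - G y\<bar> \<le> \<bar>f x - f y\<bar> + e * dist x y" by argo
  next
    fix x y assume xy: "x \<in> X" "y \<in> X" "d \<le> dist x y"
    have "\<bar>(G x - G y) - (f x - f y)\<bar> \<le> e / 2 * dist x y + 0 / N"
      unfolding mean using close[OF xy] N by (intro abs_mean_le_all_but_one) auto
    also have "\<dots> \<le> e * dist x y" using \<open>e > 0\<close> by simp
    finally show "\<bar>(G x - G y) - (f x - f y)\<bar> \<le> e * dist x y" .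
  qed
qed

end

section \<open>Interpolation along a sequence of pairs\<close>

lemma interp_op_cmult: "interp_op xs ys (\<lambda>x. c * f x) = (\<lambda>n. c * interp_op xs ys f n)"
  by (simp add: interp_op_def fun_eq_iff right_diff_distrib)

lemma interp_op_add:
  "interp_op xs ys (\<lambda>x. f x + g x) = (\<lambda>n. interp_op xs ys f n + interp_op xs ys g n)"
  by (simp add: interp_op_def fun_eq_iff diff_divide_distrib add_divide_distrib)

lemma difference_quotient_diff_le:
  fixes f :: "'a::metric_space \<Rightarrow> real"
  assumes f: "K-lipschitz_on X f" and X: "x \<in> X" "y \<in> X" "x' \<in> X" "y' \<in> X"
    and e: "0 < e" "e \<le> dist x y" "e \<le> dist x' y'"
  shows "e * \<bar>(f x - f y) / dist x y - (f x' - f y') / dist x' y'\<bar>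
    \<le> 2 * K * (dist x x' + dist y y')"
proof -
  let ?q = "(f x - f y) / dist x y" and ?q' = "(f x' - f y') / dist x' y'"
  have lip: "\<bar>f s - f t\<bar> \<le> K * dist s t" if "s \<in> X" "t \<in> X" for s t
    using lipschitz_onD[OF f that] by (simp add: dist_real_def)
  have pos: "0 < dist x y" "0 < dist x' y'" using e by linarith+
  have q': "\<bar>?q'\<bar> \<le> K" using lip[OF X(3,4)] pos by (simp add: pos_divide_le_eq)
  have "\<bar>dist x' y' - dist x y\<bar> \<le> dist x x' + dist y y'"
    using dist_triangle[of x' y' x] dist_triangle[of x y' y]
      dist_triangle[of x y x'] dist_triangle[of x' y y'] by (simp add: dist_commute)
  then have "\<bar>?q' * (dist x' y' - dist x y)\<bar> \<le> K * (dist x x' + dist y y')"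
    unfolding abs_mult using q' lipschitz_on_nonneg[OF f] by (intro mult_mono) auto
  moreover have "\<bar>(f x - f x') - (f y - f y')\<bar> \<le> K * (dist x x' + dist y y')"
    using lip[OF X(1,3)] lip[OF X(2,4)] by (simp add: distrib_left)
  moreover have "dist x y * (?q - ?q')
      = ((f x - f x') - (f y - f y')) + ?q' * (dist x' y' - dist x y)"
    using pos by (simp add: field_simps)
  ultimately have "\<bar>dist x y * (?q - ?q')\<bar> \<le> 2 * K * (dist x x' + dist y y')" by argo
  moreover have "e * \<bar>?q - ?q'\<bar> \<le> \<bar>dist x y * (?q - ?q')\<bar>"
    unfolding abs_mult using e by (intro mult_right_mono) auto
  ultimately show ?thesis by linarith
qed

lemma finite_if_uniformly_separated_in_compact:
  fixes p :: "'i \<Rightarrow> 'b::metric_space"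
  assumes "compact C" "p ` I \<subseteq> C" "e > 0"
    and separated: "\<And>i j. i \<in> I \<Longrightarrow> j \<in> I \<Longrightarrow> i \<noteq> j \<Longrightarrow> e \<le> dist (p i) (p j)"
  shows "finite I"
proof -
  have "uniform_discrete (p ` I)" using separated \<open>e > 0\<close> by (intro uniformI2[of e]) auto
  then have "closed (p ` I)" "discrete (p ` I)"
    by (auto intro: uniform_discrete_imp_closed uniform_discrete_imp_discrete)
  moreover from this(1) have "compact (p ` I)"
    using compact_Int_closed[OF \<open>compact C\<close>] \<open>p ` I \<subseteq> C\<close> by (metis Int_absorb1)
  ultimately have "finite (p ` I)" using discrete_compact_finite_iff by blast
  moreover have "inj_on p I" using separated \<open>e > 0\<close> by (fastforce intro: inj_onI)
  ultimately show ?thesis by (rule finite_imageD)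
qed

lemma c0_subset_linfty: "c0 \<subseteq> linfty"
  unfolding c0_def linfty_def using convergent_imp_bounded convergentI by blast

lemma finite_support_in_c0: "(\<And>n. n \<ge> N \<Longrightarrow> \<alpha> n = 0) \<Longrightarrow> \<alpha> \<in> c0"
  unfolding c0_def by (auto intro!: tendsto_eventually eventually_sequentiallyI)

lemma unit_sequence_in_c0: "(\<lambda>m. if m = n then 1 else 0) \<in> c0"
  by (rule finite_support_in_c0[of "Suc n"]) auto

lemma cmult_in_c0: "\<alpha> \<in> c0 \<Longrightarrow> (\<lambda>n. c * \<alpha> n) \<in> c0"
  by (simp add: c0_def tendsto_mult_right_zero)

lemma interpolation_of_unit_ball:
  assumes "V \<subseteq> linfty" and V: "\<And>c \<alpha>. \<alpha> \<in> V \<Longrightarrow> (\<lambda>n. c * \<alpha> n) \<in> V"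
    and F: "\<And>c f. f \<in> F \<Longrightarrow> (\<lambda>x. c * f x) \<in> F"
    and ball: "\<And>\<alpha>. \<alpha> \<in> V \<Longrightarrow> \<forall>n. \<bar>\<alpha> n\<bar> \<le> 1 \<Longrightarrow> \<exists>f\<in>F. interp_op xs ys f = \<alpha>"
  shows "\<forall>\<alpha>\<in>V. \<exists>f\<in>F. interp_op xs ys f = \<alpha>"
proof
  fix \<alpha> assume \<alpha>: "\<alpha> \<in> V"
  then obtain B where B: "B > 0" "\<And>n. \<bar>\<alpha> n\<bar> \<le> B"
    using \<open>V \<subseteq> linfty\<close> by (auto simp: linfty_def bounded_pos)
  then have "\<forall>n. \<bar>1 / B * \<alpha> n\<bar> \<le> 1" by (simp add: abs_mult pos_divide_le_eq)
  then obtain f where f: "f \<in> F" "interp_op xs ys f = (\<lambda>n. 1 / B * \<alpha> n)"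
    using ball[OF V[OF \<alpha>]] by blast
  then have "interp_op xs ys (\<lambda>x. B * f x) = \<alpha>" using B(1) by (simp add: interp_op_cmult)
  with F[OF f(1)] show "\<exists>f\<in>F. interp_op xs ys f = \<alpha>" by blast
qed

lemma Lip0_cmult: "f \<in> Lip0 X z \<Longrightarrow> (\<lambda>x. c * f x) \<in> Lip0 X z"
  using lipball_cmult by (fastforce simp: Lip0_iff_lipball)

lemma lip0_cmult: "f \<in> lip0 X z \<Longrightarrow> (\<lambda>x. c * f x) \<in> lip0 X z"
  by (simp add: lip0_iff Lip0_cmult little_lipschitz_on_cmult)

locale pair_sequence = pointed_metric_subset X z
  for X :: "'a::metric_space set" and z +
  fixes xs ys :: "nat \<Rightarrow> 'a"
  assumes xs_in: "\<And>n. xs n \<in> X" and ys_in: "\<And>n. ys n \<in> X"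
    and distinct_pairs: "\<And>n. xs n \<noteq> ys n"
begin

abbreviation T :: "('a \<Rightarrow> real) \<Rightarrow> nat \<Rightarrow> real" where
  "T \<equiv> interp_op xs ys"

abbreviation S_norm :: "(nat \<Rightarrow> real) \<Rightarrow> real" where
  "S_norm lam \<equiv> dual_norm X z (Sop xs ys lam)"

lemma Lip0_lipnorm_le_iff: "f \<in> Lip0 X z \<and> lipnorm X f \<le> K \<longleftrightarrow> f \<in> lipball X z K"
  using lipnorm_le_iff_lipball[OF xs_in ys_in distinct_pairs] .

lemma abs_interp_op_le: "f \<in> lipball X z K \<Longrightarrow> \<bar>T f n\<bar> \<le> K"
  using abs_diff_le_lipball[OF _ xs_in[of n] ys_in[of n]] distinct_pairs[of n]
  by (simp add: interp_op_def pos_divide_le_eq)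

lemma abs_interp_op_diff_le:
  assumes "\<bar>(g (xs n) - g (ys n)) - (f (xs n) - f (ys n))\<bar> \<le> e * dist (xs n) (ys n)"
  shows "\<bar>T g n - T f n\<bar> \<le> e"
  using assms distinct_pairs[of n]
  by (simp add: interp_op_def pos_divide_le_eq flip: diff_divide_distrib)

lemma ex_dist_pairs_lower_bound:
  obtains d where "d > 0" "\<And>n. n < N \<Longrightarrow> d \<le> dist (xs n) (ys n)"
proof
  let ?D = "insert 1 ((\<lambda>n. dist (xs n) (ys n)) ` {..<N})"
  show "0 < Min ?D" using distinct_pairs by (subst Min_gr_iff) auto
  show "Min ?D \<le> dist (xs n) (ys n)" if "n < N" for n using that by (intro Min_le) auto
qed

lemma interp_op_suminf:
  assumes "\<And>k. g k \<in> lipball X z (c k)" "summable c"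
  shows "T (\<lambda>x. \<Sum>k. g k x) n = (\<Sum>k. T (g k) n)"
proof -
  have summable: "summable (\<lambda>k. g k x)" if "x \<in> X" for x
    using assms that by (rule summable_lipball)
  show ?thesis
    unfolding interp_op_def
    by (simp add: suminf_diff suminf_divide summable_diff summable xs_in ys_in)
qed

lemma interp_op_image_convex:
  assumes "u \<in> T ` lipball X z K" "v \<in> T ` lipball X z K" "0 \<le> t" "t \<le> 1"
  shows "(\<lambda>n. (1 - t) * u n + t * v n) \<in> T ` lipball X z K"
proof -
  obtain f g where "f \<in> lipball X z K" "u = T f" "g \<in> lipball X z K" "v = T g"
    using assms(1,2) by blast
  then show ?thesis
    using lipball_convex[of f X z K g t] assms(3,4)
    by (intro image_eqI[of _ _ "\<lambda>x. (1 - t) * f x + t * g x"])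
      (simp_all add: interp_op_add interp_op_cmult)
qed

lemma compact_interp_op_image: "compact (T ` lipball X z K)"
proof -
  let ?B = "{f \<in> lipball X z K. \<forall>x. x \<notin> X \<longrightarrow> f x = 0}"
  have cont: "continuous_on UNIV T"
    unfolding interp_op_def
    by (intro continuous_on_coordinatewise_then_product continuous_intros)
      (use distinct_pairs in auto)
  have "compact (T ` ?B)"
    by (rule compact_continuous_image[OF continuous_on_subset[OF cont subset_UNIV]
          compact_lipball_restrict])
  moreover have "T ` lipball X z K = T ` ?B"
  proof (intro antisym image_subsetI)
    fix f assume f: "f \<in> lipball X z K"
    define g where "g x = (if x \<in> X then f x else 0)" for x
    have "g \<in> ?B"
      using f abs_diff_le_lipball[OF f] lipball_base[OF f] lipball_radius_nonneg[OF f] base_in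
      by (auto simp: g_def intro!: lipballI)
    moreover have "T f = T g" using xs_in ys_in by (simp add: interp_op_def g_def fun_eq_iff)
    ultimately show "T f \<in> T ` ?B" by blast
  qed auto
  ultimately show ?thesis by simp
qed

lemma
  assumes "lam \<in> l1" "f \<in> lipball X z K"
  shows abs_Sop_le: "\<bar>Sop xs ys lam f\<bar> \<le> K * l1norm lam"
    and Sop_cmult: "Sop xs ys lam (\<lambda>x. c * f x) = c * Sop xs ys lam f"
proof -
  show "\<bar>Sop xs ys lam f\<bar> \<le> K * l1norm lam"
    unfolding Sop_def using assms abs_interp_op_le by (intro abs_l1_pairing_le)
  have "summable (\<lambda>n. lam n * T f n)" using assms abs_interp_op_le by (intro summable_l1_mult)
  then show "Sop xs ys lam (\<lambda>x. c * f x) = c * Sop xs ys lam f"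
    unfolding Sop_def interp_op_cmult by (simp add: suminf_mult[symmetric] mult_ac)
qed

lemma S_norm_le_iff:
  assumes "lam \<in> l1" "K > 0"
  shows "K * S_norm lam \<le> B \<longleftrightarrow> (\<forall>f\<in>lipball X z K. Sop xs ys lam f \<le> B)"
proof -
  have "S_norm lam = (SUP f\<in>lipball X z 1. \<bar>Sop xs ys lam f\<bar>)"
    unfolding dual_norm_def using Lip0_lipnorm_le_iff[of _ 1] by (intro arg_cong[of _ _ Sup]) auto
  moreover have "bdd_above ((\<lambda>f. \<bar>Sop xs ys lam f\<bar>) ` lipball X z 1)"
    using abs_Sop_le[OF assms(1)] by (rule bdd_aboveI2)
  moreover have "lipball X z 1 \<noteq> {}" using zero_in_lipball[of 1] by fastforce
  ultimately have "S_norm lam \<le> B / K \<longleftrightarrow> (\<forall>f\<in>lipball X z 1. \<bar>Sop xs ys lam f\<bar> \<le> B / K)"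
    by (simp add: cSUP_le_iff)
  also have "\<dots> \<longleftrightarrow> (\<forall>f\<in>lipball X z K. Sop xs ys lam f \<le> B)"
  proof (intro iffI ballI)
    fix f assume unit: "\<forall>f\<in>lipball X z 1. \<bar>Sop xs ys lam f\<bar> \<le> B / K" and f: "f \<in> lipball X z K"
    have "(\<lambda>x. 1 / K * f x) \<in> lipball X z 1" using lipball_cmult[OF f, of "1 / K"] \<open>K > 0\<close> by simp
    then have "\<bar>1 / K * Sop xs ys lam f\<bar> \<le> B / K" using unit Sop_cmult[OF assms(1) f] by metis
    then show "Sop xs ys lam f \<le> B" using \<open>K > 0\<close> by (simp add: abs_mult divide_le_cancel)
  next
    fix f assume scaled: "\<forall>f\<in>lipball X z K. Sop xs ys lam f \<le> B" and f: "f \<in> lipball X z 1"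
    have "c * Sop xs ys lam f \<le> B" if "\<bar>c\<bar> = K" for c
      using scaled lipball_cmult[OF f, of c] that by (simp add: Sop_cmult[OF assms(1) f, symmetric])
    from this[of K] this[of "- K"] show "\<bar>Sop xs ys lam f\<bar> \<le> B / K"
      using \<open>K > 0\<close> by (simp add: abs_le_iff pos_le_divide_eq mult.commute)
  qed
  finally show ?thesis using \<open>K > 0\<close> by (simp add: pos_le_divide_eq mult.commute)
qed

lemma S_norm_nonneg: "lam \<in> l1 \<Longrightarrow> 0 \<le> S_norm lam"
  using S_norm_le_iff[of lam 1 "S_norm lam"] zero_in_lipball[of 1 X z]
  by (fastforce simp: Sop_def interp_op_def)

lemma S_norm_le_l1norm: "lam \<in> l1 \<Longrightarrow> S_norm lam \<le> l1norm lam"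
  using S_norm_le_iff[of lam 1 "l1norm lam"] abs_Sop_le[of lam _ 1] by fastforce

lemma dist_pairs_tendsto_0:
  assumes "compact X" "K > 0"
    and unit: "\<And>n. \<exists>f\<in>lipball X z K. T f = (\<lambda>m. if m = n then 1 else 0)"
  shows "(\<lambda>n. dist (xs n) (ys n)) \<longlonglongrightarrow> 0"
  unfolding tendsto_iff
proof (intro allI impI)
  fix e :: real assume "e > 0"
  define far where "far = {n. e \<le> dist (xs n) (ys n)}"
  have "finite far"
  proof (rule finite_if_uniformly_separated_in_compact)
    show "compact (X \<times> X)" using \<open>compact X\<close> by (simp add: compact_Times)
    show "(\<lambda>n. (xs n, ys n)) ` far \<subseteq> X \<times> X" using xs_in ys_in by auto
    show "0 < e / (4 * K)" using \<open>e > 0\<close> \<open>K > 0\<close> by simp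
    fix n m assume "n \<in> far" "m \<in> far" "n \<noteq> m"
    obtain f where f: "f \<in> lipball X z K" "T f = (\<lambda>m. if m = n then 1 else 0)" using unit by blast
    have "e = e * \<bar>T f n - T f m\<bar>" using f(2) \<open>n \<noteq> m\<close> by simp
    also have "\<dots> \<le> 2 * K * (dist (xs n) (xs m) + dist (ys n) (ys m))"
      unfolding interp_op_def using f(1) \<open>n \<in> far\<close> \<open>m \<in> far\<close> \<open>e > 0\<close>
      by (intro difference_quotient_diff_le[of K X] xs_in ys_in) (auto simp: lipball_def far_def)
    also have "\<dots> \<le> 2 * K * (2 * dist (xs n, ys n) (xs m, ys m))"
      using dist_fst_le[of "(xs n, ys n)" "(xs m, ys m)"] \<open>K > 0\<close>
        dist_snd_le[of "(xs n, ys n)" "(xs m, ys m)"] by (intro mult_left_mono) auto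
    finally show "e / (4 * K) \<le> dist (xs n, ys n) (xs m, ys m)"
      using \<open>K > 0\<close> by (simp add: pos_divide_le_eq mult_ac)
  qed
  then have "\<forall>\<^sub>F n in sequentially. n \<notin> far"
    by (simp add: eventually_cofinite flip: cofinite_eq_sequentially)
  then show "\<forall>\<^sub>F n in sequentially. dist (dist (xs n) (ys n)) 0 < e"
    by eventually_elim (simp add: far_def)
qed

lemma interp_op_little_lipschitz_in_c0:
  assumes "little_lipschitz_on X g" and lim: "(\<lambda>n. dist (xs n) (ys n)) \<longlonglongrightarrow> 0"
  shows "T g \<in> c0"
  unfolding c0_def mem_Collect_eq tendsto_iff
proof (intro allI impI)
  fix e :: real assume "e > 0"
  then obtain d where d: "d > 0" "\<forall>x\<in>X. \<forall>y\<in>X. dist x y < d \<longrightarrow> \<bar>g x - g y\<bar> \<le> e / 2 * dist x y"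
    using assms(1) unfolding little_lipschitz_on_iff by (meson half_gt_zero)
  have "\<forall>\<^sub>F n in sequentially. dist (xs n) (ys n) < d" using order_tendstoD(2)[OF lim d(1)] .
  then show "\<forall>\<^sub>F n in sequentially. dist (T g n) 0 < e"
  proof eventually_elim
    case (elim n)
    then have "\<bar>T g n\<bar> \<le> e / 2"
      using d(2) xs_in ys_in distinct_pairs by (simp add: interp_op_def pos_divide_le_eq)
    then show ?case using \<open>e > 0\<close> by simp
  qed
qed

section \<open>Interpolation constants\<close>

abbreviation Lip0_constants :: "real set" where
  "Lip0_constants \<equiv> c0_interp_constants X (Lip0 X z) xs ys"

abbreviation lip0_constants :: "real set" where
  "lip0_constants \<equiv> c0_interp_constants X (lip0 X z) xs ys"

lemma c0_interp_constants_iff: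
  assumes "F \<subseteq> Lip0 X z"
  shows "K \<in> c0_interp_constants X F xs ys \<longleftrightarrow> K > 0 \<and>
    (\<forall>\<alpha>\<in>c0. (\<forall>n. \<bar>\<alpha> n\<bar> \<le> 1) \<longrightarrow> (\<exists>f\<in>F \<inter> lipball X z K. T f = \<alpha>))"
proof -
  have "(\<exists>f\<in>F. lipnorm X f \<le> K \<and> T f = \<alpha>) \<longleftrightarrow> (\<exists>f\<in>F \<inter> lipball X z K. T f = \<alpha>)" for \<alpha>
    using Lip0_lipnorm_le_iff[of _ K] assms by blast
  then show ?thesis by (simp add: c0_interp_constants_def)
qed

lemma Lip0_constantD:
  assumes "K \<in> Lip0_constants" "\<alpha> \<in> c0" "\<forall>n. \<bar>\<alpha> n\<bar> \<le> 1"
  obtains f where "f \<in> lipball X z K" "T f = \<alpha>"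
  using assms c0_interp_constants_iff[of "Lip0 X z" K] by blast

lemma Lip0_constant_ge_1:
  assumes "K \<in> Lip0_constants"
  shows "K \<ge> 1"
proof -
  obtain f where "f \<in> lipball X z K" "T f = (\<lambda>m. if m = 0 then 1 else 0)"
    by (rule Lip0_constantD[OF assms unit_sequence_in_c0[of 0]]) auto
  then show ?thesis using abs_interp_op_le[of f K 0] by simp
qed

lemma l1norm_le_of_Lip0_constant:
  assumes K: "K \<in> Lip0_constants" and lam: "lam \<in> l1"
  shows "l1norm lam \<le> K * S_norm lam"
  unfolding l1norm_def
proof (rule suminf_le_const)
  show "summable (\<lambda>n. \<bar>lam n\<bar>)" using lam by (simp add: l1_def)
  fix N
  define \<alpha> where "\<alpha> n = (if n < N then sgn (lam n) else 0)" for n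
  have "\<alpha> \<in> c0" by (rule finite_support_in_c0[of N]) (simp add: \<alpha>_def)
  moreover have "\<forall>n. \<bar>\<alpha> n\<bar> \<le> 1" by (simp add: \<alpha>_def abs_sgn_eq)
  ultimately obtain f where f: "f \<in> lipball X z K" "T f = \<alpha>" by (rule Lip0_constantD[OF K])
  have "(\<Sum>n<N. \<bar>lam n\<bar>) = (\<Sum>n<N. lam n * \<alpha> n)"
    by (intro sum.cong) (auto simp: \<alpha>_def abs_sgn)
  also have "\<dots> = Sop xs ys lam f"
    unfolding Sop_def f(2) by (rule suminf_finite[symmetric]) (auto simp: \<alpha>_def)
  also have "\<dots> \<le> K * S_norm lam"
    using S_norm_le_iff[OF lam, of K] f(1) Lip0_constant_ge_1[OF K] by fastforce
  finally show "(\<Sum>n<N. \<bar>lam n\<bar>) \<le> K * S_norm lam" .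
qed

lemma interpolation_of_l1norm_le:
  assumes "K > 0" and le: "\<And>lam. lam \<in> l1 \<Longrightarrow> l1norm lam \<le> K * S_norm lam"
    and \<alpha>: "\<And>n. \<bar>\<alpha> n\<bar> \<le> 1"
  obtains f where "f \<in> lipball X z K" "T f = \<alpha>"
proof -
  have "\<alpha> \<in> T ` lipball X z K"
  proof (rule ccontr)
    assume "\<alpha> \<notin> T ` lipball X z K"
    moreover have "T ` lipball X z K \<noteq> {}" using zero_in_lipball[of K] \<open>K > 0\<close> by fastforce
    moreover have "\<bar>u n\<bar> \<le> K" if "u \<in> T ` lipball X z K" for u n
      using that abs_interp_op_le by blast
    ultimately obtain lam u where lam: "lam \<in> l1" and u: "u \<in> T ` lipball X z K"
      and optimal: "\<And>v. v \<in> T ` lipball X z K \<Longrightarrow> (\<Sum>n. lam n * v n) \<le> (\<Sum>n. lam n * u n)"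
      and strict: "(\<Sum>n. lam n * u n) < (\<Sum>n. lam n * \<alpha> n)"
      using l1_separation[OF compact_interp_op_image _ interp_op_image_convex, of K K \<alpha> 1] \<alpha>
      by blast
    have "l1norm lam \<le> K * S_norm lam" by (rule le[OF lam])
    also have "\<dots> \<le> (\<Sum>n. lam n * u n)"
      unfolding S_norm_le_iff[OF lam \<open>K > 0\<close>] using optimal by (simp add: Sop_def)
    also have "\<dots> < (\<Sum>n. lam n * \<alpha> n)" by (rule strict)
    also have "\<dots> \<le> l1norm lam" using abs_l1_pairing_le[of lam \<alpha> 1, OF lam \<alpha>] by simp
    finally show False by simp
  qed
  then show thesis using that by blast
qed

lemma Lip0_constants_iff_l1norm_le:
  "K \<in> Lip0_constants \<longleftrightarrow> K > 0 \<and> (\<forall>lam\<in>l1. l1norm lam \<le> K * S_norm lam)"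
proof
  assume "K \<in> Lip0_constants"
  then show "K > 0 \<and> (\<forall>lam\<in>l1. l1norm lam \<le> K * S_norm lam)"
    using Lip0_constant_ge_1 l1norm_le_of_Lip0_constant by fastforce
next
  assume "K > 0 \<and> (\<forall>lam\<in>l1. l1norm lam \<le> K * S_norm lam)"
  then show "K \<in> Lip0_constants"
    using interpolation_of_l1norm_le Lip0_iff_lipball
    unfolding c0_interp_constants_iff[OF order_refl] by (metis IntI)
qed

lemma Lip0_constant_interpolation:
  assumes "K \<in> Lip0_constants" "\<And>n. \<bar>\<alpha> n\<bar> \<le> 1"
  obtains f where "f \<in> lipball X z K" "T f = \<alpha>"
  using assms interpolation_of_l1norm_le unfolding Lip0_constants_iff_l1norm_le by blast

lemma Lip_interp_constants_eq: "Lip_interp_constants X z xs ys = Lip0_constants"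
proof (intro set_eqI iffI)
  fix K assume "K \<in> Lip_interp_constants X z xs ys"
  then show "K \<in> Lip0_constants"
    using c0_subset_linfty unfolding Lip_interp_constants_def c0_interp_constants_def by fastforce
next
  fix K assume K: "K \<in> Lip0_constants"
  then have "\<exists>f\<in>Lip0 X z. lipnorm X f \<le> K \<and> T f = \<alpha>" if "\<forall>n. \<bar>\<alpha> n\<bar> \<le> 1" for \<alpha>
    using Lip0_constant_interpolation[OF K] Lip0_lipnorm_le_iff that by metis
  then show "K \<in> Lip_interp_constants X z xs ys"
    using Lip0_constant_ge_1[OF K] by (simp add: Lip_interp_constants_def)
qed

lemma Lip0_constants_eq_atLeast:
  assumes "Lip0_constants \<noteq> {}"
  shows "Lip0_constants = {Inf Lip0_constants..}"
proof (intro set_eqI iffI)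
  have ge_1: "bdd_below Lip0_constants" "1 \<le> Inf Lip0_constants"
    using assms bdd_belowI[OF Lip0_constant_ge_1] by (auto intro: cInf_greatest Lip0_constant_ge_1)
  fix K
  show "K \<in> {Inf Lip0_constants..}" if "K \<in> Lip0_constants"
    using cInf_lower[OF that ge_1(1)] by simp
  assume "K \<in> {Inf Lip0_constants..}"
  then have K: "Inf Lip0_constants \<le> K" by simp
  have "l1norm lam \<le> K * S_norm lam" if lam: "lam \<in> l1" for lam
  proof (cases "S_norm lam = 0")
    case True
    then show ?thesis using assms l1norm_le_of_Lip0_constant[OF _ lam] by fastforce
  next
    case False
    then have pos: "S_norm lam > 0" using S_norm_nonneg[OF lam] by simp
    then have "l1norm lam / S_norm lam \<le> Inf Lip0_constants"
      using assms l1norm_le_of_Lip0_constant[OF _ lam]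
      by (intro cInf_greatest) (auto simp: pos_divide_le_eq)
    then show ?thesis using K pos by (simp add: pos_divide_le_eq[symmetric])
  qed
  then show "K \<in> Lip0_constants" using ge_1(2) K by (simp add: Lip0_constants_iff_l1norm_le)
qed

lemma Sop_lower_constants_iff:
  "J \<in> Sop_lower_constants X z xs ys \<longleftrightarrow> J > 0 \<and> 1 / J \<in> Lip0_constants"
  unfolding Lip0_constants_iff_l1norm_le Sop_lower_constants_def
  by (auto simp: pos_le_divide_eq mult.commute)

lemma Lip_interpolating_of_constant:
  assumes "K \<in> Lip0_constants"
  shows "Lip_interpolating X z xs ys"
  unfolding Lip_interpolating_def
proof (rule interpolation_of_unit_ball[OF order_refl _ Lip0_cmult])
  show "(\<lambda>n. c * \<alpha> n) \<in> linfty" if "\<alpha> \<in> linfty" for c \<alpha>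
    using bounded_scaling[of "range \<alpha>" c] that by (simp add: linfty_def image_image)
  show "\<exists>f\<in>Lip0 X z. T f = \<alpha>" if "\<forall>n. \<bar>\<alpha> n\<bar> \<le> 1" for \<alpha>
    using Lip0_constant_interpolation[OF assms, of \<alpha>] that Lip0_iff_lipball by metis
qed

lemma Lip_c0_interpolating_of_constant:
  assumes "K \<in> lip0_constants"
  shows "Lip_c0_interpolating (lip0 X z) xs ys"
  unfolding Lip_c0_interpolating_def
  using assms unfolding c0_interp_constants_def
  by (intro interpolation_of_unit_ball c0_subset_linfty cmult_in_c0 lip0_cmult) blast+

lemma Sop_into_isomorphism_of_constant:
  assumes "K \<in> Lip0_constants"
  shows "Sop_into_isomorphism X z xs ys"
proof -
  have "K > 0" using Lip0_constant_ge_1[OF assms] by simp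
  then have "1 / K * l1norm lam \<le> S_norm lam \<and> S_norm lam \<le> 1 * l1norm lam" if "lam \<in> l1" for lam
    using l1norm_le_of_Lip0_constant[OF assms that] S_norm_le_l1norm[OF that]
    by (simp add: pos_divide_le_eq mult.commute)
  then show ?thesis
    unfolding Sop_into_isomorphism_def using \<open>K > 0\<close> by (metis zero_less_divide_1_iff)
qed

lemma eq_Inf_Lip0_constants_iff_Sop:
  assumes "M \<ge> 1"
  shows "Lip0_constants \<noteq> {} \<and> M = Inf Lip0_constants \<longleftrightarrow>
    Sop_into_isomorphism X z xs ys \<and> 1 / M \<in> Sop_lower_constants X z xs ys \<and>
    (\<forall>J\<in>Sop_lower_constants X z xs ys. J \<le> 1 / M)"
proof (cases "Lip0_constants = {}")
  case True
  then show ?thesis by (simp add: Sop_lower_constants_iff)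
next
  case False
  define m where "m = Inf Lip0_constants"
  have eq: "Lip0_constants = {m..}" unfolding m_def by (rule Lip0_constants_eq_atLeast[OF False])
  then have "m \<ge> 1" using Lip0_constant_ge_1 by simp
  then have lower: "Sop_lower_constants X z xs ys = {0<..1 / m}"
    by (auto simp: Sop_lower_constants_iff eq pos_le_divide_eq mult.commute)
  have "r \<in> {0<..s} \<and> (\<forall>J\<in>{0<..s}. J \<le> r) \<longleftrightarrow> r = s" if "0 < s" for r s :: real
    using that by (auto intro: antisym)
  from this[of "1 / m" "1 / M"]
  have "1 / M \<in> Sop_lower_constants X z xs ys \<and> (\<forall>J\<in>Sop_lower_constants X z xs ys. J \<le> 1 / M)
      \<longleftrightarrow> 1 / M = 1 / m"
    unfolding lower using \<open>m \<ge> 1\<close> by simp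
  moreover have "Sop_into_isomorphism X z xs ys"
    using False Sop_into_isomorphism_of_constant by blast
  moreover have "1 / M = 1 / m \<longleftrightarrow> M = m" using \<open>m \<ge> 1\<close> \<open>M \<ge> 1\<close> by auto
  ultimately show ?thesis using False unfolding m_def by blast
qed

end

section \<open>Interpolation by little Lipschitz functions\<close>

locale separated_pair_sequence =
  little_lipschitz_separation X z a + pair_sequence X z xs ys
  for X :: "'a::metric_space set" and z a xs ys +
  assumes compact_X: "compact X"
begin

lemma little_lipschitz_interpolates_approximately:
  assumes K: "K \<in> Lip0_constants" and \<beta>: "\<beta> \<in> c0" "\<forall>n. \<bar>\<beta> n\<bar> \<le> 1" and "\<eta> > 0"
  obtains g where "g \<in> lipball X z (K + \<eta>)" "little_lipschitz_on X g" "\<And>n. \<bar>\<beta> n - T g n\<bar> \<le> \<eta>"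
proof -
  obtain f where f: "f \<in> lipball X z K" "T f = \<beta>" using Lip0_constantD[OF K \<beta>] .
  obtain n0 where n0: "\<And>n. n \<ge> n0 \<Longrightarrow> \<bar>\<beta> n\<bar> < \<eta> / 4"
    using LIMSEQ_D[of \<beta> 0 "\<eta> / 4"] \<beta>(1) \<open>\<eta> > 0\<close> by (auto simp: c0_def)
  obtain d where "d > 0" and d_le: "\<And>n. n < n0 \<Longrightarrow> d \<le> dist (xs n) (ys n)"
    using ex_dist_pairs_lower_bound by blast
  obtain g where g: "g z = 0" "little_lipschitz_on X g"
    and slope: "\<And>x y. x \<in> X \<Longrightarrow> y \<in> X \<Longrightarrow> \<bar>g x - g y\<bar> \<le> \<bar>f x - f y\<bar> + \<eta> / 2 * dist x y"
    and close: "\<And>x y. x \<in> X \<Longrightarrow> y \<in> X \<Longrightarrow> d \<le> dist x y \<Longrightarrow>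
      \<bar>(g x - g y) - (f x - f y)\<bar> \<le> \<eta> / 2 * dist x y"
    using little_lipschitz_approximation[OF compact_X f(1) \<open>d > 0\<close>, of "\<eta> / 2"] \<open>\<eta> > 0\<close> by auto
  have "g \<in> lipball X z (K + \<eta>)"
  proof (rule lipballI)
    show "0 \<le> K + \<eta>" using lipball_radius_nonneg[OF f(1)] \<open>\<eta> > 0\<close> by simp
    fix x y assume xy: "x \<in> X" "y \<in> X"
    have "\<eta> / 2 * dist x y \<le> \<eta> * dist x y" using \<open>\<eta> > 0\<close> by simp
    then show "\<bar>g x - g y\<bar> \<le> (K + \<eta>) * dist x y"
      using slope[OF xy] abs_diff_le_lipball[OF f(1) xy] unfolding distrib_right by linarith
  qed (rule g(1))
  moreover have "\<bar>\<beta> n - T g n\<bar> \<le> \<eta>" for n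
  proof (cases "n < n0")
    case True
    have "\<bar>T g n - \<beta> n\<bar> \<le> \<eta> / 2"
      unfolding f(2)[symmetric]
      by (rule abs_interp_op_diff_le[OF close[OF xs_in ys_in d_le[OF True]]])
    then show ?thesis using \<open>\<eta> > 0\<close> by linarith
  next
    case False
    have "\<bar>T g n\<bar> \<le> (\<bar>f (xs n) - f (ys n)\<bar> + \<eta> / 2 * dist (xs n) (ys n)) / dist (xs n) (ys n)"
      using divide_right_mono[OF slope[OF xs_in[of n] ys_in[of n]] zero_le_dist]
      by (simp add: interp_op_def)
    also have "\<dots> = \<bar>\<beta> n\<bar> + \<eta> / 2"
      using distinct_pairs[of n] by (simp add: interp_op_def add_divide_distrib flip: f(2))
    finally show ?thesis using n0[of n] False by linarith
  qed
  ultimately show thesis using g(2) by (intro that)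
qed

lemma little_lipschitz_interpolates_approximately_scaled:
  assumes K: "K \<in> Lip0_constants" and \<beta>: "\<beta> \<in> c0" "\<forall>n. \<bar>\<beta> n\<bar> \<le> s" and "\<eta> > 0" "s > 0"
  obtains g where "g \<in> lipball X z (s * (K + \<eta>))" "little_lipschitz_on X g"
    and "\<And>n. \<bar>\<beta> n - T g n\<bar> \<le> s * \<eta>"
proof -
  have "(\<lambda>n. 1 / s * \<beta> n) \<in> c0" using \<beta>(1) by (rule cmult_in_c0)
  moreover have "\<forall>n. \<bar>1 / s * \<beta> n\<bar> \<le> 1"
    using \<beta>(2) \<open>s > 0\<close> by (simp add: abs_mult pos_divide_le_eq)
  ultimately obtain g where g: "g \<in> lipball X z (K + \<eta>)" "little_lipschitz_on X g"
    and error: "\<And>n. \<bar>1 / s * \<beta> n - T g n\<bar> \<le> \<eta>"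
    using little_lipschitz_interpolates_approximately[OF K _ _ \<open>\<eta> > 0\<close>] by blast
  have "\<bar>\<beta> n - T (\<lambda>x. s * g x) n\<bar> \<le> s * \<eta>" for n
  proof -
    have "\<beta> n - T (\<lambda>x. s * g x) n = s * (1 / s * \<beta> n - T g n)"
      using \<open>s > 0\<close> by (simp add: interp_op_cmult right_diff_distrib)
    then show ?thesis using mult_left_mono[OF error, of s] \<open>s > 0\<close> by (simp add: abs_mult)
  qed
  moreover have "(\<lambda>x. s * g x) \<in> lipball X z (s * (K + \<eta>))"
    using lipball_cmult[OF g(1), of s] \<open>s > 0\<close> by simp
  ultimately show thesis using little_lipschitz_on_cmult[OF g(2)] by (intro that)
qed

lemma successive_residuals:
  assumes K: "K \<in> Lip0_constants" and \<alpha>: "\<alpha> \<in> c0" "\<forall>n. \<bar>\<alpha> n\<bar> \<le> 1" and "\<eta> > 0"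
  obtains b :: "nat \<Rightarrow> nat \<Rightarrow> real" and g
  where "b 0 = \<alpha>" "\<And>k n. \<bar>b k n\<bar> \<le> \<eta> ^ k" "\<And>k. b (Suc k) = (\<lambda>n. b k n - T (g k) n)"
    and "\<And>k. g k \<in> lipball X z (\<eta> ^ k * (K + \<eta>))" "\<And>k. little_lipschitz_on X (g k)"
proof -
  have lim: "(\<lambda>n. dist (xs n) (ys n)) \<longlonglongrightarrow> 0"
  proof (rule dist_pairs_tendsto_0[OF compact_X])
    show "K > 0" using Lip0_constant_ge_1[OF K] by simp
    show "\<exists>f\<in>lipball X z K. T f = (\<lambda>m. if m = n then 1 else 0)" for n
      by (rule Lip0_constantD[OF K unit_sequence_in_c0[of n]]) auto
  qed
  let ?P = "\<lambda>k \<beta>. (\<beta> \<in> c0 \<and> (\<forall>n. \<bar>\<beta> n\<bar> \<le> \<eta> ^ k)) \<and> (k = 0 \<longrightarrow> \<beta> = \<alpha>)"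
  let ?Q = "\<lambda>k \<beta> \<beta>'. \<exists>g. g \<in> lipball X z (\<eta> ^ k * (K + \<eta>)) \<and> little_lipschitz_on X g
      \<and> \<beta>' = (\<lambda>n. \<beta> n - T g n)"
  have "\<exists>\<beta>'. ?P (Suc k) \<beta>' \<and> ?Q k \<beta> \<beta>'" if \<beta>: "?P k \<beta>" for k \<beta>
  proof -
    obtain g where g: "g \<in> lipball X z (\<eta> ^ k * (K + \<eta>))" "little_lipschitz_on X g"
      and error: "\<And>n. \<bar>\<beta> n - T g n\<bar> \<le> \<eta> ^ k * \<eta>"
      using little_lipschitz_interpolates_approximately_scaled[OF K _ _ \<open>\<eta> > 0\<close>, of \<beta> "\<eta> ^ k"]
        \<beta> \<open>\<eta> > 0\<close> by auto
    have "(\<lambda>n. \<beta> n - T g n) \<in> c0"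
      using \<beta> interp_op_little_lipschitz_in_c0[OF g(2) lim] tendsto_diff[of \<beta> 0 _ "T g" 0]
      by (simp add: c0_def)
    then show ?thesis
      using g error
      by (intro exI[of _ "\<lambda>n. \<beta> n - T g n"] conjI exI[of _ g]) (simp_all add: mult.commute)
  qed
  moreover have "\<exists>\<beta>. ?P 0 \<beta>" using \<alpha> by simp
  ultimately have "\<exists>b. \<forall>k. ?P k (b k) \<and> ?Q k (b k) (b (Suc k))" by (intro dependent_nat_choice)
  then obtain b where b: "\<forall>k. ?P k (b k)" and "\<forall>k. ?Q k (b k) (b (Suc k))" by blast
  from choice[OF this(2)] obtain g where g: "\<forall>k. g k \<in> lipball X z (\<eta> ^ k * (K + \<eta>))
      \<and> little_lipschitz_on X (g k) \<and> b (Suc k) = (\<lambda>n. b k n - T (g k) n)" ..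
  show thesis by (rule that[of b g]) (use b g in auto)
qed

text \<open>The successive approximation of the open mapping theorem, with total norm
  \<open>(K + \<eta>) / (1 - \<eta>) = L\<close> for the right choice of \<open>\<eta>\<close>.\<close>

lemma little_lipschitz_interpolates_exactly:
  assumes K: "K \<in> Lip0_constants" and "K < L" and \<alpha>: "\<alpha> \<in> c0" "\<forall>n. \<bar>\<alpha> n\<bar> \<le> 1"
  obtains f where "f \<in> lipball X z L" "little_lipschitz_on X f" "T f = \<alpha>"
proof -
  have "K \<ge> 1" by (rule Lip0_constant_ge_1[OF K])
  define \<eta> where "\<eta> = (L - K) / (1 + L)"
  have \<eta>: "0 < \<eta>" "\<eta> < 1" "K + \<eta> = (1 - \<eta>) * L"
    using \<open>K \<ge> 1\<close> \<open>K < L\<close> by (auto simp: \<eta>_def field_simps)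
  have total: "summable (\<lambda>k. \<eta> ^ k * (K + \<eta>))" "(\<Sum>k. \<eta> ^ k * (K + \<eta>)) = L"
    using sums_mult2[OF geometric_sums[of \<eta>], of "K + \<eta>"] \<eta> by (auto simp: sums_iff)
  obtain b g where b0: "b 0 = \<alpha>" and b: "\<And>k n. \<bar>b k n\<bar> \<le> \<eta> ^ k"
    and b_Suc: "\<And>k. b (Suc k) = (\<lambda>n. b k n - T (g k) n)"
    and g: "\<And>k. g k \<in> lipball X z (\<eta> ^ k * (K + \<eta>))" "\<And>k. little_lipschitz_on X (g k)"
    by (rule successive_residuals[OF K \<alpha> \<eta>(1)]) (rule that)
  define f where "f x = (\<Sum>k. g k x)" for x
  have "f \<in> lipball X z L"
    unfolding f_def using lipball_suminf[OF g(1) total(1)] by (simp only: total(2))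
  moreover have "little_lipschitz_on X f"
    unfolding f_def by (rule little_lipschitz_on_suminf[OF g total(1)])
  moreover have "T f = \<alpha>"
  proof
    fix n
    have "(\<lambda>k. b k n) \<longlonglongrightarrow> 0"
      using b \<eta> by (intro Lim_null_comparison[OF _ LIMSEQ_power_zero[of \<eta>]]) auto
    then have "(\<lambda>k. b k n - b (Suc k) n) sums (b 0 n - 0)" by (rule telescope_sums')
    then show "T f n = \<alpha> n"
      unfolding f_def interp_op_suminf[OF g(1) total(1)] by (simp add: b_Suc b0 sums_iff)
  qed
  ultimately show thesis by (rule that)
qed

lemma lip0_constants_subset: "lip0_constants \<subseteq> Lip0_constants"
  unfolding c0_interp_constants_def lip0_def by blast

lemma greaterThan_subset_lip0_constants:
  assumes K: "K \<in> Lip0_constants"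
  shows "{K<..} \<subseteq> lip0_constants"
proof
  fix L assume "L \<in> {K<..}"
  then have "K < L" by simp
  have "\<exists>f\<in>lip0 X z. lipnorm X f \<le> L \<and> T f = \<alpha>" if \<alpha>: "\<alpha> \<in> c0" "\<forall>n. \<bar>\<alpha> n\<bar> \<le> 1" for \<alpha>
  proof -
    obtain f where "f \<in> lipball X z L" "little_lipschitz_on X f" "T f = \<alpha>"
      using little_lipschitz_interpolates_exactly[OF K \<open>K < L\<close> \<alpha>] by blast
    then show ?thesis using Lip0_lipnorm_le_iff[of f L] lip0_iff by blast
  qed
  then show "L \<in> lip0_constants"
    using \<open>K < L\<close> Lip0_constant_ge_1[OF K] by (simp add: c0_interp_constants_def)
qed

lemma
  shows lip0_constants_empty_iff: "lip0_constants = {} \<longleftrightarrow> Lip0_constants = {}"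
    and Inf_lip0_constants_eq: "Inf lip0_constants = Inf Lip0_constants"
proof -
  have "K + 1 \<in> lip0_constants" if "K \<in> Lip0_constants" for K
    using greaterThan_subset_lip0_constants[OF that] by auto
  then show empty_iff: "lip0_constants = {} \<longleftrightarrow> Lip0_constants = {}"
    using lip0_constants_subset by blast
  show "Inf lip0_constants = Inf Lip0_constants"
  proof (cases "Lip0_constants = {}")
    case True
    then show ?thesis using empty_iff by simp
  next
    case False
    have "Inf Lip0_constants \<in> Lip0_constants"
      by (subst (2) Lip0_constants_eq_atLeast[OF False]) simp
    then have "{Inf Lip0_constants<..} \<subseteq> lip0_constants" by (rule greaterThan_subset_lip0_constants)
    moreover have "bdd_below lip0_constants"
      using lip0_constants_subset Lip0_constant_ge_1 by (intro bdd_belowI) blast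
    ultimately have "Inf lip0_constants \<le> Inf {Inf Lip0_constants<..}"
      by (intro cInf_superset_mono) auto
    moreover have "Inf Lip0_constants \<le> Inf lip0_constants"
      using False empty_iff lip0_constants_subset bdd_belowI[OF Lip0_constant_ge_1]
      by (intro cInf_superset_mono) auto
    ultimately show ?thesis by simp
  qed
qed

end

theorem theorem4p6:
  fixes X :: "'a::metric_space set" and z :: 'a
    and xs ys :: "nat \<Rightarrow> 'a" and M :: real
  assumes "compact X" and "z \<in> X"
    and "separates_points_uniformly X z"
    and "\<And>n. xs n \<in> X" and "\<And>n. ys n \<in> X" and "\<And>n. xs n \<noteq> ys n"
    and "inj (\<lambda>n. (xs n, ys n))"
    and "M \<ge> 1"
  shows
   "((Lip_interpolating X z xs ys \<and> Lip_interp_constants X z xs ys \<noteq> {}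
        \<and> Lip_interp_constant X z xs ys = M)
     \<longleftrightarrow> (Sop_into_isomorphism X z xs ys \<and> 1 / M \<in> Sop_lower_constants X z xs ys
        \<and> (\<forall>J\<in>Sop_lower_constants X z xs ys. J \<le> 1 / M)))
  \<and> ((Lip_interpolating X z xs ys \<and> Lip_interp_constants X z xs ys \<noteq> {}
        \<and> Lip_interp_constant X z xs ys = M)
     \<longleftrightarrow> (Lip_c0_interpolating (lip0 X z) xs ys \<and> c0_interp_constants X (lip0 X z) xs ys \<noteq> {}
        \<and> M = Inf (c0_interp_constants X (lip0 X z) xs ys)))
  \<and> ((Lip_interpolating X z xs ys \<and> Lip_interp_constants X z xs ys \<noteq> {}
        \<and> Lip_interp_constant X z xs ys = M)
     \<longleftrightarrow> (c0_interp_constants X (Lip0 X z) xs ys \<noteq> {}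
        \<and> M = Inf (c0_interp_constants X (Lip0 X z) xs ys)))"
proof -
  obtain a where separation: "\<forall>x\<in>X. \<forall>y\<in>X. \<exists>f\<in>lip0 X z. lipnorm X f \<le> a \<and> \<bar>f x - f y\<bar> = dist x y"
    using assms(3) unfolding separates_points_uniformly_def by blast
  interpret pair_sequence X z xs ys by standard (use assms in auto)
  interpret separated_pair_sequence X z a xs ys
  proof
    show "\<exists>h\<in>lipball X z a. little_lipschitz_on X h \<and> \<bar>h x - h y\<bar> = dist x y"
      if "x \<in> X" "y \<in> X" for x y
      using separation that Lip0_lipnorm_le_iff lip0_iff by metis
  qed fact
  have "Lip_interpolating X z xs ys \<and> Lip_interp_constants X z xs ys \<noteq> {}
      \<and> Lip_interp_constant X z xs ys = M \<longleftrightarrow> Lip0_constants \<noteq> {} \<and> M = Inf Lip0_constants"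
    unfolding Lip_interp_constant_def Lip_interp_constants_eq
    by (auto intro: Lip_interpolating_of_constant)
  moreover have "Lip0_constants \<noteq> {} \<and> M = Inf Lip0_constants \<longleftrightarrow>
      Lip_c0_interpolating (lip0 X z) xs ys \<and> lip0_constants \<noteq> {} \<and> M = Inf lip0_constants"
    unfolding lip0_constants_empty_iff[symmetric] Inf_lip0_constants_eq
    by (auto intro: Lip_c0_interpolating_of_constant)
  moreover note eq_Inf_Lip0_constants_iff_Sop[OF \<open>M \<ge> 1\<close>]
  ultimately show ?thesis by (simp only: simp_thms)
qed

end
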